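(* Let $\mathbb{X}=\mathbb{R}$ and $\mathbb{A}=[0,+\infty)$. Assume that there exists $\alpha^*\in[0,1)$ such that for all $\alpha\in(\alpha^*,1]$: (i) the function $x\mapsto\mathbb{E}[h_\alpha(x-D)]$ is quasiconvex on $\mathbb{R}$; and (ii) $\lim_{x\to-\infty}\mathbb{E}[h_\alpha(x-D)]>K+\inf_{x\in\mathbb{R}}\mathbb{E}[h_\alpha(x-D)]$. Assume also that the function $x\mapsto\mathbb{E}[h_1(x-D)]$ is strictly decreasing on $(-\infty,x^{\min}_1]$. Then the limit $$s^*:=\lim_{\alpha\uparrow1}s_\alpha$$ exists and $s^*\le x^{\min}_1$.
   Context: Inventory model with states $x\in\mathbb{R}$ and actions $a\in[0,+\infty)$. Constants $K>0$ (fixed ordering cost), $\bar c>0$ (unit ordering cost). $D_1,D_2,\ldots$ are i.i.d. nonnegative finite random variables, $D$ has the same distribution as $D_1$, $\mathbb{E}[D]<+\infty$, $P(D>0)>0$. The holding/backlog cost function $h:\mathbb{R}\to\mathbb{R}$ is such that $x\mapsto\mathbb{E}[h(x-D)]$ is finite, continuous and nonnegative and $\mathbb{E}[h(x-D)]\to+\infty$ as $|x|\to+\infty$. Dynamics: $x_{t+1}=x_t+a_t-D_{t+1}$. One-step cost: $c(x,a)=K\mathbf{1}_{\{a>0\}}+\bar c a+\mathbb{E}[h(x+a-D)]$. Policies may be randomized and history-dependent; $v_\alpha(x)=\inf_\pi\mathbb{E}_x^\pi[\sum_{t=0}^\infty\alpha^t c(x_t,a_t)]$ for $\alpha\in[0,1)$.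 For $\alpha\in(0,1]$: $h_\alpha(x):=h(x)+(1-\alpha)\bar c x+\bar c\,\mathbb{E}[D]$ and $x^{\min}_\alpha:=\min\{\operatorname{arg\,min}_{x\in\mathbb{R}}\mathbb{E}[h_\alpha(x-D)]\}$ (the smallest minimizer). $G_\alpha(x):=\bar c x+\mathbb{E}[h(x-D)]+\alpha\mathbb{E}[v_\alpha(x-D)]$. For $\alpha\in(\alpha^*,1)$: $S_\alpha\in\operatorname{arg\,min}_{x}G_\alpha(x)$ and $s_\alpha:=\inf\{x\le S_\alpha:G_\alpha(x)\le K+G_\alpha(S_\alpha)\}$ (the optimal discounted lower threshold; it does not depend on the choice of the minimizer $S_\alpha$). A function $f$ on $\mathbb{R}$ is quasiconvex if $f(\lambda x+(1-\lambda)y)\le\max\{f(x),f(y)\}$ for all $x,y$ and $\lambda\in[0,1]$. *)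

theory Defs
  imports "HOL-Probability.Probability"
begin

definition quasiconvex :: "(real \<Rightarrow> real) \<Rightarrow> bool" where
  "quasiconvex f \<longleftrightarrow>
     (\<forall>x y. \<forall>l\<in>{0..1}. f (l * x + (1 - l) * y) \<le> max (f x) (f y))"

(* Ds n is the demand D_n, only the indices n \<ge> 1 being used; D is a generic demand.
   Finiteness of E[h(x - D)] is integrability, which includes measurability of h(x - D). *)
locale inventory_model = prob_space M
  for M :: "'w measure" +
  fixes Ds :: "nat \<Rightarrow> 'w \<Rightarrow> real" and D :: "'w \<Rightarrow> real"
    and K cbar :: real and h :: "real \<Rightarrow> real"
  assumes K_pos: "K > 0"
    and cbar_pos: "cbar > 0"
    and demands_indep: "indep_vars (\<lambda>_. borel) Ds {1..}"
    and demands_ident: "\<And>n. n \<ge> 1 \<Longrightarrow> distr M borel (Ds n) = distr M borel (Ds 1)"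
    and demands_nonneg: "\<And>n. n \<ge> 1 \<Longrightarrow> AE \<omega> in M. 0 \<le> Ds n \<omega>"
    and D_rv: "random_variable borel D"
    and D_ident: "distr M borel D = distr M borel (Ds 1)"
    and D_integrable: "integrable M D"
    and D_nontrivial: "prob {\<omega> \<in> space M. D \<omega> > 0} > 0"
    and h_integrable: "\<And>x. integrable M (\<lambda>\<omega>. h (x - D \<omega>))"
    and Eh_continuous: "continuous_on UNIV (\<lambda>x. expectation (\<lambda>\<omega>. h (x - D \<omega>)))"
    and Eh_nonneg: "\<And>x. 0 \<le> expectation (\<lambda>\<omega>. h (x - D \<omega>))"
    and Eh_coercive: "filterlim (\<lambda>x. expectation (\<lambda>\<omega>. h (x - D \<omega>))) at_top at_infinity"

definition one_step_cost ::
  "'w measure \<Rightarrow> ('w \<Rightarrow> real) \<Rightarrow> real \<Rightarrow> real \<Rightarrow> (real \<Rightarrow> real) \<Rightarrow> real \<Rightarrow> real \<Rightarrow> real" where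
  "one_step_cost M D K cbar h x a =
     K * of_bool (a > 0) + cbar * a + (LINT \<omega>|M. h (x + a - D \<omega>))"

abbreviation action_space :: "real measure" where
  "action_space \<equiv> restrict_space borel {0..}"

abbreviation state_action_space :: "(real \<times> real) measure" where
  "state_action_space \<equiv> borel \<Otimes>\<^sub>M action_space"

(* \<pi> t \<omega> x is the law of the action a_t when the past is \<omega> i = (x_i, a_i) for i < t
   and the current state is x_t = x. *)
type_synonym policy = "nat \<Rightarrow> (nat \<Rightarrow> real \<times> real) \<Rightarrow> real \<Rightarrow> real measure"

definition policies :: "policy set" where
  "policies = {\<pi>. \<forall>t. (\<lambda>(\<omega>, x). \<pi> t \<omega> x) \<in>
     measurable ((\<Pi>\<^sub>M i\<in>{0..<t}. state_action_space) \<Otimes>\<^sub>M borel) (prob_algebra action_space)}"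

(* Conditional law of the state x_t given the past: x_0 = x is given, and
   x_t = x_{t-1} + a_{t-1} - D_t with D_t independent of the past. *)
fun state_law ::
  "'w measure \<Rightarrow> (nat \<Rightarrow> 'w \<Rightarrow> real) \<Rightarrow> real \<Rightarrow> nat \<Rightarrow> (nat \<Rightarrow> real \<times> real) \<Rightarrow> real measure" where
  "state_law M Ds x 0 \<omega> = return borel x"
| "state_law M Ds x (Suc t) \<omega> =
     distr M borel (\<lambda>w. fst (\<omega> t) + snd (\<omega> t) - Ds (Suc t) w)"

definition step_law ::
  "'w measure \<Rightarrow> (nat \<Rightarrow> 'w \<Rightarrow> real) \<Rightarrow> real \<Rightarrow> policy \<Rightarrow> nat \<Rightarrow> (nat \<Rightarrow> real \<times> real)
     \<Rightarrow> (real \<times> real) measure" where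
  "step_law M Ds x \<pi> t \<omega> =
     bind (state_law M Ds x t \<omega>) (\<lambda>y. distr (\<pi> t \<omega> y) state_action_space (Pair y))"

(* The strategic measure P_x^\<pi> on trajectories (x_0, a_0), (x_1, a_1), ... given by the
   Ionescu-Tulcea theorem; Ionescu_Tulcea_step_law below shows that it applies. *)
definition trajectory_law ::
  "'w measure \<Rightarrow> (nat \<Rightarrow> 'w \<Rightarrow> real) \<Rightarrow> real \<Rightarrow> policy \<Rightarrow> (nat \<Rightarrow> real \<times> real) measure" where
  "trajectory_law M Ds x \<pi> =
     projective_family.lim UNIV
       (Ionescu_Tulcea.CI (step_law M Ds x \<pi>) (\<lambda>_. state_action_space)) (\<lambda>_. state_action_space)"

(* Costs are nonnegative, so expected total costs are taken in [0, \<infinity>]. *)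
definition discounted_value ::
  "'w measure \<Rightarrow> (nat \<Rightarrow> 'w \<Rightarrow> real) \<Rightarrow> ('w \<Rightarrow> real) \<Rightarrow> real \<Rightarrow> real \<Rightarrow> (real \<Rightarrow> real)
     \<Rightarrow> real \<Rightarrow> real \<Rightarrow> ennreal" where
  "discounted_value M Ds D K cbar h \<alpha> x =
     (INF \<pi>\<in>policies. \<integral>\<^sup>+\<omega>. (\<Sum>t. ennreal (\<alpha> ^ t *
        one_step_cost M D K cbar h (fst (\<omega> t)) (snd (\<omega> t)))) \<partial>trajectory_law M Ds x \<pi>)"

definition h_disc ::
  "'w measure \<Rightarrow> ('w \<Rightarrow> real) \<Rightarrow> real \<Rightarrow> (real \<Rightarrow> real) \<Rightarrow> real \<Rightarrow> real \<Rightarrow> real" where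
  "h_disc M D cbar h \<alpha> x = h x + (1 - \<alpha>) * cbar * x + cbar * (LINT \<omega>|M. D \<omega>)"

definition Eh_disc ::
  "'w measure \<Rightarrow> ('w \<Rightarrow> real) \<Rightarrow> real \<Rightarrow> (real \<Rightarrow> real) \<Rightarrow> real \<Rightarrow> real \<Rightarrow> real" where
  "Eh_disc M D cbar h \<alpha> x = (LINT \<omega>|M. h_disc M D cbar h \<alpha> (x - D \<omega>))"

definition x_min ::
  "'w measure \<Rightarrow> ('w \<Rightarrow> real) \<Rightarrow> real \<Rightarrow> (real \<Rightarrow> real) \<Rightarrow> real \<Rightarrow> real" where
  "x_min M D cbar h \<alpha> = (LEAST x. is_arg_min (Eh_disc M D cbar h \<alpha>) (\<lambda>_. True) x)"

definition G_disc ::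
  "'w measure \<Rightarrow> (nat \<Rightarrow> 'w \<Rightarrow> real) \<Rightarrow> ('w \<Rightarrow> real) \<Rightarrow> real \<Rightarrow> real \<Rightarrow> (real \<Rightarrow> real)
     \<Rightarrow> real \<Rightarrow> real \<Rightarrow> ereal" where
  "G_disc M Ds D K cbar h \<alpha> x =
     ereal (cbar * x + (LINT \<omega>|M. h (x - D \<omega>)))
     + ereal \<alpha> * enn2ereal (\<integral>\<^sup>+\<omega>. discounted_value M Ds D K cbar h \<alpha> (x - D \<omega>) \<partial>M)"

(* The lower threshold s_\<alpha> belonging to the minimizer S of G_\<alpha>; the infimum is taken in the
   extended reals, so no boundedness of the set is presupposed. *)
definition lower_threshold ::
  "'w measure \<Rightarrow> (nat \<Rightarrow> 'w \<Rightarrow> real) \<Rightarrow> ('w \<Rightarrow> real) \<Rightarrow> real \<Rightarrow> real \<Rightarrow> (real \<Rightarrow> real)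
     \<Rightarrow> real \<Rightarrow> real \<Rightarrow> ereal" where
  "lower_threshold M Ds D K cbar h \<alpha> S =
     (INF x\<in>{x. x \<le> S \<and> G_disc M Ds D K cbar h \<alpha> x \<le> ereal K + G_disc M Ds D K cbar h \<alpha> S}. ereal x)"

context inventory_model
begin

lemma Ds_measurable: "n \<ge> 1 \<Longrightarrow> random_variable borel (Ds n)"
  using demands_indep by (auto simp: indep_vars_def)

lemma state_law_measurable:
  "state_law M Ds x t \<in> measurable (\<Pi>\<^sub>M i\<in>{0..<t}. state_action_space) (prob_algebra borel)"
proof (cases t)
  case 0
  then have "state_law M Ds x t = (\<lambda>_. return borel x)" by auto
  moreover have "return borel x \<in> space (prob_algebra borel)"
    by (simp add: space_prob_algebra prob_space_return)
  ultimately show ?thesis by simp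
next
  case (Suc n)
  have eq: "state_law M Ds x t = (\<lambda>\<omega>. distr M borel (\<lambda>w. fst (\<omega> n) + snd (\<omega> n) - Ds (Suc n) w))"
    using Suc by auto
  have [measurable]: "random_variable borel (Ds (Suc n))"
    by (rule Ds_measurable) simp
  have c[measurable]: "(\<lambda>\<omega>. \<omega> n) \<in> measurable (\<Pi>\<^sub>M i\<in>{0..<t}. state_action_space) state_action_space"
    using Suc by (intro measurable_component_singleton) simp
  have s0: "snd \<in> borel_measurable (state_action_space)"
    by (rule measurable_compose[OF measurable_snd]) (simp add: measurable_restrict_space1)
  have [measurable]: "(\<lambda>\<omega>. snd (\<omega> n)) \<in> borel_measurable (\<Pi>\<^sub>M i\<in>{0..<t}. state_action_space)"
    using measurable_compose[OF c s0] .
  have [measurable]: "(\<lambda>\<omega>. fst (\<omega> n)) \<in> borel_measurable (\<Pi>\<^sub>M i\<in>{0..<t}. state_action_space)"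
    using measurable_compose[OF c measurable_fst] .
  have MM: "(\<lambda>_. M) \<in> measurable (\<Pi>\<^sub>M i\<in>{0..<t}. state_action_space) (prob_algebra M)"
    by (intro measurable_const) (simp add: space_prob_algebra prob_space_axioms)
  show ?thesis unfolding eq
    by (rule measurable_distr_prob_space2[OF MM]) measurable
qed

lemma step_law_measurable:
  assumes "\<pi> \<in> policies"
  shows "step_law M Ds x \<pi> t
    \<in> measurable (\<Pi>\<^sub>M i\<in>{0..<t}. state_action_space) (prob_algebra state_action_space)"
proof -
  have p: "(\<lambda>p. \<pi> t (fst p) (snd p)) \<in>
     measurable ((\<Pi>\<^sub>M i\<in>{0..<t}. state_action_space) \<Otimes>\<^sub>M borel) (prob_algebra action_space)"
    using assms unfolding policies_def case_prod_beta by blast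
  have d: "(\<lambda>p. distr (\<pi> t (fst p) (snd p)) state_action_space (Pair (snd p))) \<in>
     measurable ((\<Pi>\<^sub>M i\<in>{0..<t}. state_action_space) \<Otimes>\<^sub>M borel) (prob_algebra state_action_space)"
    by (rule measurable_distr_prob_space2[OF p]) measurable
  show ?thesis unfolding step_law_def[abs_def]
    by (rule measurable_bind_prob_space2[OF state_law_measurable])
       (use d in \<open>simp add: case_prod_beta\<close>)
qed

lemma Ionescu_Tulcea_step_law:
  assumes "\<pi> \<in> policies"
  shows "Ionescu_Tulcea (step_law M Ds x \<pi>) (\<lambda>_. state_action_space)"
proof (rule Ionescu_Tulcea.intro)
  show "step_law M Ds x \<pi> t
      \<in> measurable (\<Pi>\<^sub>M i\<in>{0..<t}. state_action_space) (subprob_algebra state_action_space)" for t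
    using step_law_measurable[OF assms] by (rule measurable_prob_algebraD)
  show "prob_space (step_law M Ds x \<pi> t \<omega>)"
    if "\<omega> \<in> space (\<Pi>\<^sub>M i\<in>{0..<t}. state_action_space)" for t \<omega>
    using measurable_space[OF step_law_measurable[OF assms] that] by (simp add: space_prob_algebra)
qed

end

end

theory Submission
  imports Defs
begin

text \<open>
  Dynamic programming shows that \<open>v\<^sub>\<alpha>\<close> solves the optimality equation. Crediting the unit ordering
  cost turns the one-step cost into \<open>H\<^sub>\<alpha>(x) = E h\<^sub>\<alpha>(x - D)\<close>, and, with \<open>\<lambda>\<^sub>\<alpha> = (1 - \<alpha>) (K + min G\<^sub>\<alpha>)\<close>,
  the function \<open>u(x) = v\<^sub>\<alpha>(x) + c x - K - min G\<^sub>\<alpha>\<close> satisfies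
  \<open>u(x) = min 0 (H\<^sub>\<alpha>(x) - \<lambda>\<^sub>\<alpha> + \<alpha> E u(x - D))\<close> for \<open>x \<le> S\<^sub>\<alpha>\<close>. Since \<open>u \<ge> -K = u(S\<^sub>\<alpha>)\<close>, this forces
  \<open>H\<^sub>\<alpha>(S\<^sub>\<alpha>) \<le> \<lambda>\<^sub>\<alpha>\<close>, so by quasiconvexity \<open>s\<^sub>\<alpha>\<close> is the smallest solution of \<open>H\<^sub>\<alpha>(x) = \<lambda>\<^sub>\<alpha>\<close>.
  Comparing \<open>u\<close> for two discount factors on \<open>x \<le> S\<^sub>\<alpha>\<close> shows that \<open>\<lambda>\<^sub>\<alpha>\<close> is Lipschitz in \<open>\<alpha>\<close> near \<open>1\<close>,
  hence convergent, and \<open>s\<^sub>\<alpha>\<close> converges because \<open>H\<^sub>1\<close> is continuous and strictly decreasing to the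
  left of its smallest minimizer.
\<close>

section \<open>Lower semicontinuity and lower limits in the extended nonnegative reals\<close>

text \<open>The setup cost jumps at order size 0, so one-step costs are only lower semicontinuous.
  The sequential form suits Fatou's lemma and the extraction of convergent near-minimizers.\<close>

definition lsc :: "(real \<Rightarrow> ennreal) \<Rightarrow> bool" where
  "lsc f \<longleftrightarrow> (\<forall>X x. X \<longlonglongrightarrow> x \<longrightarrow> f x \<le> liminf (\<lambda>n. f (X n)))"

lemma lscD: "lsc f \<Longrightarrow> X \<longlonglongrightarrow> x \<Longrightarrow> f x \<le> liminf (\<lambda>n. f (X n))"
  by (auto simp: lsc_def)

lemma borel_measurable_lsc:
  assumes "lsc f" shows "f \<in> borel_measurable borel"
proof (rule borel_measurableI_le)
  fix y
  have "closed {x. f x \<le> y}"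
  proof (unfold closed_sequential_limits, safe)
    fix X l assume X: "\<forall>n. X n \<in> {x. f x \<le> y}" and "X \<longlonglongrightarrow> l"
    then have "f l \<le> liminf (\<lambda>n. f (X n))"
      by (intro lscD[OF assms])
    also have "\<dots> \<le> liminf (\<lambda>n. y)"
      using X by (intro Liminf_mono) simp
    finally show "f l \<le> y" by (simp add: Liminf_const)
  qed
  then show "{x \<in> space borel. f x \<le> y} \<in> sets borel" by simp
qed

lemma lsc_SUP:
  fixes f :: "'i \<Rightarrow> real \<Rightarrow> ennreal"
  assumes "\<And>n. lsc (f n)" shows "lsc (\<lambda>x. SUP n. f n x)"
  unfolding lsc_def
proof safe
  fix X x assume X: "X \<longlonglongrightarrow> (x :: real)"
  show "(SUP n. f n x) \<le> liminf (\<lambda>k. SUP n. f n (X k))"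
  proof (rule SUP_least)
    fix n
    have "f n x \<le> liminf (\<lambda>k. f n (X k))" by (rule lscD[OF assms X])
    also have "\<dots> \<le> liminf (\<lambda>k. SUP n. f n (X k))"
      by (intro Liminf_mono always_eventually allI SUP_upper) simp
    finally show "f n x \<le> liminf (\<lambda>k. SUP n. f n (X k))" .
  qed
qed

lemma liminf_add_ennreal:
  fixes f g :: "nat \<Rightarrow> ennreal"
  shows "liminf f + liminf g \<le> liminf (\<lambda>n. f n + g n)"
proof -
  have "liminf f + liminf g = (SUP n. (INF m\<in>{n..}. f m) + (INF m\<in>{n..}. g m))"
    unfolding liminf_SUP_INF
    by (rule ennreal_SUP_add[symmetric]) (auto intro!: incseq_SucI INF_superset_mono)
  also have "\<dots> \<le> liminf (\<lambda>n. f n + g n)"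
    unfolding liminf_SUP_INF
    by (intro SUP_mono') (auto intro!: INF_greatest add_mono INF_lower)
  finally show ?thesis .
qed

lemma liminf_cmult_ennreal:
  fixes f :: "nat \<Rightarrow> ennreal"
  shows "c * liminf f \<le> liminf (\<lambda>n. c * f n)"
  unfolding liminf_SUP_INF SUP_mult_left_ennreal
  by (intro SUP_mono') (auto intro!: INF_greatest mult_left_mono INF_lower)

text \<open>For fixed \<open>m\<close>, eventually \<open>m \<le> r k\<close>, so monotonicity
  reduces the moving index to \<open>m\<close>, where lower semicontinuity applies; the supremum
  over \<open>m\<close> comes last.\<close>

lemma lsc_incseq_liminf:
  fixes f :: "nat \<Rightarrow> real \<Rightarrow> ennreal"
  assumes inc: "\<And>x. incseq (\<lambda>k. f k x)" and lsc: "\<And>k. lsc (f k)"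
    and r: "strict_mono r" and z: "z \<longlonglongrightarrow> x"
  shows "(SUP k. f k x) \<le> liminf (\<lambda>k. f (r k) (z k))"
proof (rule SUP_least)
  fix m
  have "f m x \<le> liminf (\<lambda>k. f m (z k))"
    by (rule lscD[OF lsc z])
  also have "\<dots> \<le> liminf (\<lambda>k. f (r k) (z k))"
  proof (rule Liminf_mono)
    show "\<forall>\<^sub>F k in sequentially. f m (z k) \<le> f (r k) (z k)"
      using eventually_ge_at_top[of m]
    proof eventually_elim
      case (elim k)
      then have "m \<le> r k" using seq_suble[OF r, of k] by linarith
      then show ?case by (rule incseqD[OF inc])
    qed
  qed
  finally show "f m x \<le> liminf (\<lambda>k. f (r k) (z k))" .
qed

lemma quasiconvexD:
  assumes "quasiconvex f" and "x \<le> y" "y \<le> z"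
  shows "f y \<le> max (f x) (f z)"
proof (cases "x = z")
  case True then show ?thesis using assms by simp
next
  case False
  define l where "l = (z - y) / (z - x)"
  have "l * (z - x) = z - y" using False assms by (simp add: l_def)
  then have "l * x + (1 - l) * z = y" by (simp add: algebra_simps)
  moreover have "l \<in> {0..1}" using False assms by (auto simp: l_def divide_simps)
  ultimately show ?thesis using assms(1) unfolding quasiconvex_def by metis
qed

section \<open>Marginals of the trajectory law\<close>

text \<open>\<open>distr_lim\<close> identifies the marginals of the projective limit with
  \<open>CI\<close>, and on an initial segment \<open>CI\<close> is the kernel composition
  \<open>C 0 n\<close>. The argument \<open>\<lambda>_. undefined\<close> is the empty history, the
  only point of the product over no coordinates.\<close>

lemma (in Ionescu_Tulcea) nn_integral_lim_restrict:
  assumes f[measurable]: "f \<in> borel_measurable (PiM {0..<n} M)"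
  shows "(\<integral>\<^sup>+\<omega>. f (restrict \<omega> {0..<n}) \<partial>PF.lim) = (\<integral>\<^sup>+\<omega>. f \<omega> \<partial>C 0 n (\<lambda>_. undefined))"
proof -
  have up: "up_to {0..<n} = n"
    unfolding up_to_def by (rule Least_equality) (auto simp: not_le[symmetric])
  have "CI {0..<n} = C 0 n (\<lambda>_. undefined)"
    using distr_C[of n n "\<lambda>_. undefined" 0] by (simp add: CI_def up)
  then have C: "C 0 n (\<lambda>_. undefined) = distr PF.lim (PiM {0..<n} M) (\<lambda>\<omega>. restrict \<omega> {0..<n})"
    by (simp add: distr_lim)
  have "(\<lambda>\<omega>. restrict \<omega> {0..<n}) \<in> measurable PF.lim (PiM {0..<n} M)"
    by (subst measurable_cong_sets[OF PF.sets_lim refl])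
       (auto intro!: measurable_restrict_subset)
  then show ?thesis
    unfolding C by (subst nn_integral_distr) auto
qed

text \<open>Since \<open>C 0 (Suc n)\<close> is \<open>C 0 n\<close> bound to the kernel extension
  \<open>eP n\<close>, the kernel \<open>P n\<close> acts as the conditional law of coordinate
  \<open>n\<close> given the earlier ones.\<close>

lemma (in Ionescu_Tulcea) nn_integral_lim_Suc:
  assumes f[measurable]: "f \<in> borel_measurable (PiM {0..<Suc n} M)"
  shows "(\<integral>\<^sup>+\<omega>. f (restrict \<omega> {0..<Suc n}) \<partial>PF.lim) =
    (\<integral>\<^sup>+\<omega>. (\<integral>\<^sup>+p. f (fun_upd (restrict \<omega> {0..<n}) n p) \<partial>P n (restrict \<omega> {0..<n})) \<partial>PF.lim)"
proof -
  have u: "(\<lambda>_. undefined) \<in> space (PiM {0..<0} M)"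
    by (auto simp: space_PiM)
  have m: "(\<lambda>\<omega>. \<integral>\<^sup>+p. f p \<partial>eP n \<omega>) \<in> borel_measurable (PiM {0..<n} M)"
    by measurable
  have m': "(\<lambda>\<omega>. \<integral>\<^sup>+p. f (fun_upd \<omega> n p) \<partial>P n \<omega>) \<in> borel_measurable (PiM {0..<n} M)"
    by (subst measurable_cong[of _ _ "\<lambda>\<omega>. \<integral>\<^sup>+p. f p \<partial>eP n \<omega>"]) (auto simp: nn_integral_eP m)
  have "(\<integral>\<^sup>+\<omega>. f (restrict \<omega> {0..<Suc n}) \<partial>PF.lim) = (\<integral>\<^sup>+\<omega>. f \<omega> \<partial>C 0 (Suc n) (\<lambda>_. undefined))"
    by (rule nn_integral_lim_restrict) measurable
  also have "\<dots> = (\<integral>\<^sup>+\<omega>. \<integral>\<^sup>+p. f p \<partial>eP n \<omega> \<partial>C 0 n (\<lambda>_. undefined))"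
    using measurable_C[of 0 n] sets_C[OF u, of n]
    by (simp, subst nn_integral_bind[where B="PiM {0..<Suc n} M"])
       (auto simp: measurable_cong_sets[OF sets_C[OF u, of n] refl])
  also have "\<dots> = (\<integral>\<^sup>+\<omega>. \<integral>\<^sup>+p. f (fun_upd \<omega> n p) \<partial>P n \<omega> \<partial>C 0 n (\<lambda>_. undefined))"
    by (intro nn_integral_cong) (auto simp: nn_integral_eP space_C[OF u])
  finally show ?thesis
    unfolding nn_integral_lim_restrict[OF m'] .
qed

context inventory_model
begin

lemma policy_measurable:
  assumes "\<pi> \<in> policies" and \<omega>: "\<omega> \<in> space (\<Pi>\<^sub>M i\<in>{0..<t}. state_action_space)"
  shows "\<pi> t \<omega> \<in> measurable borel (prob_algebra action_space)"
proof -
  have "(\<lambda>p. \<pi> t (fst p) (snd p)) \<in>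
     measurable ((\<Pi>\<^sub>M i\<in>{0..<t}. state_action_space) \<Otimes>\<^sub>M borel) (prob_algebra action_space)"
    using assms(1) unfolding policies_def case_prod_beta by blast
  from measurable_compose[OF measurable_Pair1'[OF \<omega>] this] show ?thesis by simp
qed

lemma policy_law:
  assumes "\<pi> \<in> policies" and "\<omega> \<in> space (\<Pi>\<^sub>M i\<in>{0..<t}. state_action_space)"
  shows "\<pi> t \<omega> y \<in> space (prob_algebra action_space)"
  using measurable_space[OF policy_measurable[OF assms], of y] by simp

lemma nn_integral_step_law:
  assumes \<pi>: "\<pi> \<in> policies" and \<omega>: "\<omega> \<in> space (\<Pi>\<^sub>M i\<in>{0..<t}. state_action_space)"
    and f[measurable]: "f \<in> borel_measurable state_action_space"
  shows "(\<integral>\<^sup>+p. f p \<partial>step_law M Ds x \<pi> t \<omega>) =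
    (\<integral>\<^sup>+y. (\<integral>\<^sup>+a. f (y, a) \<partial>\<pi> t \<omega> y) \<partial>state_law M Ds x t \<omega>)"
proof -
  have sl: "state_law M Ds x t \<omega> \<in> space (prob_algebra borel)"
    using measurable_space[OF state_law_measurable \<omega>] .
  then have sets_sl: "sets (state_law M Ds x t \<omega>) = sets borel"
    by (simp add: space_prob_algebra)
  note p\<omega> = policy_measurable[OF \<pi> \<omega>]
  note py = policy_law[OF \<pi> \<omega>]
  have sets_\<pi>: "sets (\<pi> t \<omega> y) = sets action_space" for y
    using py[of y] by (simp add: space_prob_algebra)
  have d: "(\<lambda>y. distr (\<pi> t \<omega> y) state_action_space (Pair y)) \<in>
     measurable borel (prob_algebra state_action_space)"
    by (rule measurable_distr_prob_space2[OF p\<omega>]) measurable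
  have "(\<integral>\<^sup>+p. f p \<partial>step_law M Ds x \<pi> t \<omega>) =
    (\<integral>\<^sup>+y. (\<integral>\<^sup>+p. f p \<partial>distr (\<pi> t \<omega> y) state_action_space (Pair y)) \<partial>state_law M Ds x t \<omega>)"
    unfolding step_law_def
    by (rule nn_integral_bind[where B=state_action_space])
       (use d in \<open>auto simp: measurable_cong_sets[OF sets_sl refl] intro: measurable_prob_algebraD\<close>)
  also have "\<dots> = (\<integral>\<^sup>+y. (\<integral>\<^sup>+a. f (y, a) \<partial>\<pi> t \<omega> y) \<partial>state_law M Ds x t \<omega>)"
    by (intro nn_integral_cong nn_integral_distr)
       (auto simp: measurable_cong_sets[OF sets_\<pi> refl])
  finally show "(\<integral>\<^sup>+p. f p \<partial>step_law M Ds x \<pi> t \<omega>) =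
    (\<integral>\<^sup>+y. (\<integral>\<^sup>+a. f (y, a) \<partial>\<pi> t \<omega> y) \<partial>state_law M Ds x t \<omega>)" .
qed

lemma sets_trajectory_law:
  assumes "\<pi> \<in> policies"
  shows "sets (trajectory_law M Ds x \<pi>) = sets (\<Pi>\<^sub>M i\<in>UNIV. state_action_space)"
proof -
  interpret I: Ionescu_Tulcea "step_law M Ds x \<pi>" "\<lambda>_. state_action_space"
    by (rule Ionescu_Tulcea_step_law[OF assms])
  show "sets (trajectory_law M Ds x \<pi>) = sets (\<Pi>\<^sub>M i\<in>UNIV. state_action_space)"
    unfolding trajectory_law_def by (rule I.PF.sets_lim)
qed

lemma prob_space_trajectory_law:
  assumes "\<pi> \<in> policies"
  shows "prob_space (trajectory_law M Ds x \<pi>)"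
proof -
  interpret I: Ionescu_Tulcea "step_law M Ds x \<pi>" "\<lambda>_. state_action_space"
    by (rule Ionescu_Tulcea_step_law[OF assms])
  show "prob_space (trajectory_law M Ds x \<pi>)"
    unfolding trajectory_law_def
  proof
    have u: "(\<lambda>_. undefined) \<in> space (\<Pi>\<^sub>M i\<in>{0..<0::nat}. state_action_space)"
      by (simp add: space_PiM)
    have "emeasure I.PF.lim (space I.PF.lim) = (\<integral>\<^sup>+\<omega>. 1 \<partial>I.PF.lim)"
      by simp
    also have "\<dots> = (\<integral>\<^sup>+\<omega>. 1 \<partial>I.C 0 0 (\<lambda>_. undefined))"
      using I.nn_integral_lim_restrict[of "\<lambda>_. 1" 0] by simp
    also have "\<dots> = 1"
      using prob_space.emeasure_space_1[OF I.prob_space_C[OF u, of 0]] by simp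
    finally show "emeasure I.PF.lim (space I.PF.lim) = 1" .
  qed
qed

text \<open>Coordinate \<open>t\<close> is integrated first under \<open>step_law\<close>, which
  draws the state and then the action. Expectations along trajectories are computed from this
  disintegration.\<close>

lemma nn_integral_trajectory:
  assumes \<pi>: "\<pi> \<in> policies" and f[measurable]: "f \<in> borel_measurable state_action_space"
  shows "(\<integral>\<^sup>+\<omega>. f (\<omega> t) \<partial>trajectory_law M Ds x \<pi>) =
    (\<integral>\<^sup>+\<omega>. (\<integral>\<^sup>+y. (\<integral>\<^sup>+a. f (y, a) \<partial>\<pi> t (restrict \<omega> {0..<t}) y)
        \<partial>state_law M Ds x t (restrict \<omega> {0..<t})) \<partial>trajectory_law M Ds x \<pi>)"
proof -
  interpret I: Ionescu_Tulcea "step_law M Ds x \<pi>" "\<lambda>_. state_action_space"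
    by (rule Ionescu_Tulcea_step_law[OF \<pi>])
  have "(\<integral>\<^sup>+\<omega>. f (\<omega> t) \<partial>trajectory_law M Ds x \<pi>) =
    (\<integral>\<^sup>+\<omega>. f (restrict \<omega> {0..<Suc t} t) \<partial>trajectory_law M Ds x \<pi>)"
    by simp
  also have "\<dots> = (\<integral>\<^sup>+\<omega>. (\<integral>\<^sup>+p. f (fun_upd (restrict \<omega> {0..<t}) t p t)
      \<partial>step_law M Ds x \<pi> t (restrict \<omega> {0..<t})) \<partial>trajectory_law M Ds x \<pi>)"
    unfolding trajectory_law_def
    by (rule I.nn_integral_lim_Suc) measurable
  also have "\<dots> = (\<integral>\<^sup>+\<omega>. (\<integral>\<^sup>+y. (\<integral>\<^sup>+a. f (y, a) \<partial>\<pi> t (restrict \<omega> {0..<t}) y)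
        \<partial>state_law M Ds x t (restrict \<omega> {0..<t})) \<partial>trajectory_law M Ds x \<pi>)"
  proof (rule nn_integral_cong)
    fix \<omega> assume "\<omega> \<in> space (trajectory_law M Ds x \<pi>)"
    then have "\<omega> \<in> space (\<Pi>\<^sub>M i\<in>UNIV. state_action_space)"
      using sets_eq_imp_space_eq[OF sets_trajectory_law[OF \<pi>]] by simp
    then have "restrict \<omega> {0..<t} \<in> space (\<Pi>\<^sub>M i\<in>{0..<t}. state_action_space)"
      by (auto simp: space_PiM)
    from nn_integral_step_law[OF \<pi> this f]
    show "(\<integral>\<^sup>+p. f (fun_upd (restrict \<omega> {0..<t}) t p t) \<partial>step_law M Ds x \<pi> t (restrict \<omega> {0..<t})) =
      (\<integral>\<^sup>+y. (\<integral>\<^sup>+a. f (y, a) \<partial>\<pi> t (restrict \<omega> {0..<t}) y) \<partial>state_law M Ds x t (restrict \<omega> {0..<t}))"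
      by simp
  qed
  finally show ?thesis .
qed

lemma nn_integral_Ds:
  assumes [measurable]: "g \<in> borel_measurable borel"
  shows "(\<integral>\<^sup>+w. g (Ds (Suc t) w) \<partial>M) = (\<integral>\<^sup>+w. g (D w) \<partial>M)"
proof -
  have [measurable]: "random_variable borel (Ds (Suc t))" "random_variable borel D"
    by (auto intro: Ds_measurable D_rv)
  have "(\<integral>\<^sup>+w. g (Ds (Suc t) w) \<partial>M) = (\<integral>\<^sup>+y. g y \<partial>distr M borel (Ds (Suc t)))"
    by (subst nn_integral_distr) auto
  also have "\<dots> = (\<integral>\<^sup>+y. g y \<partial>distr M borel D)"
    using demands_ident[of "Suc t"] D_ident by simp
  also have "\<dots> = (\<integral>\<^sup>+w. g (D w) \<partial>M)"
    by (subst nn_integral_distr) auto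
  finally show ?thesis .
qed

lemma D_nonneg: "AE \<omega> in M. 0 \<le> D \<omega>"
proof -
  have [measurable]: "random_variable borel (Ds 1)" "random_variable borel D"
    by (rule Ds_measurable, simp) (rule D_rv)
  have "AE y in distr M borel (Ds 1). 0 \<le> y"
    using demands_nonneg[of 1] Ds_measurable[of 1] by (subst AE_distr_iff) simp_all
  then have "AE y in distr M borel D. 0 \<le> y"
    by (simp only: D_ident)
  then show ?thesis
    by (subst (asm) AE_distr_iff) auto
qed

lemma nn_integral_trajectory_state:
  assumes \<pi>: "\<pi> \<in> policies" and g[measurable]: "g \<in> borel_measurable borel"
  shows "(\<integral>\<^sup>+\<omega>. g (fst (\<omega> t)) \<partial>trajectory_law M Ds x \<pi>) =
    (\<integral>\<^sup>+\<omega>. (\<integral>\<^sup>+y. g y \<partial>state_law M Ds x t (restrict \<omega> {0..<t})) \<partial>trajectory_law M Ds x \<pi>)"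
proof -
  have "(\<integral>\<^sup>+\<omega>. g (fst (\<omega> t)) \<partial>trajectory_law M Ds x \<pi>) =
    (\<integral>\<^sup>+\<omega>. (\<integral>\<^sup>+y. (\<integral>\<^sup>+a. g (fst (y, a)) \<partial>\<pi> t (restrict \<omega> {0..<t}) y)
        \<partial>state_law M Ds x t (restrict \<omega> {0..<t})) \<partial>trajectory_law M Ds x \<pi>)"
    by (rule nn_integral_trajectory[OF \<pi>]) measurable
  also have "\<dots> = (\<integral>\<^sup>+\<omega>. (\<integral>\<^sup>+y. g y \<partial>state_law M Ds x t (restrict \<omega> {0..<t})) \<partial>trajectory_law M Ds x \<pi>)"
  proof (intro nn_integral_cong)
    fix \<omega> y assume "\<omega> \<in> space (trajectory_law M Ds x \<pi>)"
    then have "\<omega> \<in> space (\<Pi>\<^sub>M i\<in>UNIV. state_action_space)"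
      using sets_eq_imp_space_eq[OF sets_trajectory_law[OF \<pi>]] by simp
    then have "restrict \<omega> {0..<t} \<in> space (\<Pi>\<^sub>M i\<in>{0..<t}. state_action_space)"
      by (auto simp: space_PiM)
    from policy_law[OF \<pi> this, of y]
    have "prob_space (\<pi> t (restrict \<omega> {0..<t}) y)"
      by (simp add: space_prob_algebra)
    then show "(\<integral>\<^sup>+a. g (fst (y, a)) \<partial>\<pi> t (restrict \<omega> {0..<t}) y) = g y"
      by (simp add: prob_space.emeasure_space_1)
  qed
  finally show ?thesis .
qed

lemma nn_integral_trajectory_state_0:
  assumes "\<pi> \<in> policies" and g[measurable]: "g \<in> borel_measurable borel"
  shows "(\<integral>\<^sup>+\<omega>. g (fst (\<omega> 0)) \<partial>trajectory_law M Ds x \<pi>) = g x"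
  using prob_space.emeasure_space_1[OF prob_space_trajectory_law[OF assms(1)]]
  by (simp add: nn_integral_trajectory_state[OF assms] nn_integral_return)

lemma nn_integral_trajectory_state_Suc:
  assumes "\<pi> \<in> policies" and g[measurable]: "g \<in> borel_measurable borel"
  shows "(\<integral>\<^sup>+\<omega>. g (fst (\<omega> (Suc t))) \<partial>trajectory_law M Ds x \<pi>) =
    (\<integral>\<^sup>+\<omega>. (\<integral>\<^sup>+w. g (fst (\<omega> t) + snd (\<omega> t) - D w) \<partial>M) \<partial>trajectory_law M Ds x \<pi>)"
proof -
  have [measurable]: "random_variable borel (Ds (Suc t))"
    by (auto intro: Ds_measurable)
  show ?thesis
    unfolding nn_integral_trajectory_state[OF assms]
    using nn_integral_Ds[of "\<lambda>d. g (fst (_ t) + snd (_ t) - d)" t]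
    by (intro nn_integral_cong) (simp add: nn_integral_distr nn_integral_Ds[of "\<lambda>d. g (_ - d)"])
qed

section \<open>Stationary deterministic policies\<close>

definition stationary_policy :: "(real \<Rightarrow> real) \<Rightarrow> policy" where
  "stationary_policy f = (\<lambda>t \<omega> y. return action_space (f y))"

lemma stationary_policy_in_policies:
  assumes [measurable]: "f \<in> borel_measurable borel" and "\<And>y. 0 \<le> f y"
  shows "stationary_policy f \<in> policies"
proof -
  have f: "f \<in> measurable borel action_space"
    using assms by (intro measurable_restrict_space2) auto
  have "return action_space \<in> measurable action_space (prob_algebra action_space)"
    by (rule measurable_return_prob_space)
  from measurable_compose[OF measurable_compose[OF measurable_snd f] this]
  show ?thesis
    unfolding policies_def stationary_policy_def case_prod_beta by blast
qed

lemma nn_integral_trajectory_stationary: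
  assumes f[measurable]: "f \<in> borel_measurable borel" and pos: "\<And>y. 0 \<le> f y"
    and F[measurable]: "F \<in> borel_measurable state_action_space"
  shows "(\<integral>\<^sup>+\<omega>. F (\<omega> t) \<partial>trajectory_law M Ds x (stationary_policy f)) =
    (\<integral>\<^sup>+\<omega>. F (fst (\<omega> t), f (fst (\<omega> t))) \<partial>trajectory_law M Ds x (stationary_policy f))"
proof -
  note \<pi> = stationary_policy_in_policies[OF assms(1,2)]
  have f'[measurable]: "f \<in> measurable borel action_space"
    using assms by (intro measurable_restrict_space2) auto
  have "(\<integral>\<^sup>+a. F (y, a) \<partial>return action_space (f y)) = F (y, f y)" for y
    using pos[of y] by (intro nn_integral_return) (auto simp: space_restrict_space)
  then show ?thesis
    by (subst nn_integral_trajectory[OF \<pi> F],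
        subst nn_integral_trajectory_state[OF \<pi>, of "\<lambda>y. F (y, f y)"])
       (auto simp: stationary_policy_def)
qed

section \<open>The optimality equation\<close>

abbreviation Eh :: "real \<Rightarrow> real" where
  "Eh x \<equiv> expectation (\<lambda>\<omega>. h (x - D \<omega>))"

abbreviation cost :: "real \<Rightarrow> real \<Rightarrow> real" where
  "cost \<equiv> one_step_cost M D K cbar h"

lemmas D_measurable[measurable] = D_rv

lemma isCont_Eh: "isCont Eh x"
  using Eh_continuous by (simp add: continuous_on_eq_continuous_at)

lemma Eh_measurable[measurable]: "Eh \<in> borel_measurable borel"
  using Eh_continuous by (rule borel_measurable_continuous_onI)

lemma cost_nonneg: "0 \<le> a \<Longrightarrow> 0 \<le> cost x a"
  using K_pos cbar_pos Eh_nonneg[of "x + a"] by (simp add: one_step_cost_def)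

lemma snd_action_measurable[measurable]: "snd \<in> borel_measurable state_action_space"
  by (rule measurable_compose[OF measurable_snd]) (simp add: measurable_restrict_space1)

lemma cost_measurable[measurable]:
  "(\<lambda>p. cost (fst p) (snd p)) \<in> borel_measurable state_action_space"
  unfolding one_step_cost_def by measurable

section \<open>The Bellman operator and lower semicontinuity\<close>

text \<open>Values are taken in \<open>ennreal\<close>, so that value iteration, Fatou's lemma and
  monotone limits require no prior finiteness; finiteness is obtained later from
  \<open>val_lim_le\<close>.\<close>

definition Q_value :: "real \<Rightarrow> (real \<Rightarrow> ennreal) \<Rightarrow> real \<Rightarrow> real \<Rightarrow> ennreal" where
  "Q_value \<alpha> f x a = ennreal (cost x a) + ennreal \<alpha> * (\<integral>\<^sup>+\<omega>. f (x + a - D \<omega>) \<partial>M)"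

definition bellman :: "real \<Rightarrow> (real \<Rightarrow> ennreal) \<Rightarrow> real \<Rightarrow> ennreal" where
  "bellman \<alpha> f x = (INF a\<in>{0..}. Q_value \<alpha> f x a)"

lemma Q_value_mono: "(\<And>x. f x \<le> g x) \<Longrightarrow> Q_value \<alpha> f x a \<le> Q_value \<alpha> g x a"
  unfolding Q_value_def by (intro add_mono mult_left_mono nn_integral_mono) auto

lemma bellman_mono: "(\<And>x. f x \<le> g x) \<Longrightarrow> bellman \<alpha> f x \<le> bellman \<alpha> g x"
  unfolding bellman_def by (intro INF_mono') (auto intro: Q_value_mono)

lemma bellman_le: "0 \<le> a \<Longrightarrow> bellman \<alpha> f x \<le> Q_value \<alpha> f x a"
  unfolding bellman_def by (intro INF_lower) auto

lemma Q_value_measurable: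
  assumes [measurable]: "f \<in> borel_measurable borel"
  shows "(\<lambda>p. Q_value \<alpha> f (fst p) (snd p)) \<in> borel_measurable state_action_space"
  unfolding Q_value_def by measurable

lemma cost_liminf:
  assumes x: "X \<longlonglongrightarrow> x" and b: "b \<longlonglongrightarrow> a" and pos: "\<And>k. 0 \<le> b k"
  shows "ennreal (cost x a) \<le> liminf (\<lambda>k. ennreal (cost (X k) (b k)))"
proof -
  \<comment> \<open>\<open>?c\<close> freezes the setup indicator at its limit value. It then
    converges, and it lies eventually below the true cost because \<open>a > 0\<close> forces
    \<open>b k > 0\<close> for large \<open>k\<close>.\<close>
  let ?c = "\<lambda>k. K * of_bool (a > 0) + cbar * b k + Eh (X k + b k)"
  have "?c \<longlonglongrightarrow> cost x a"
    unfolding one_step_cost_def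
    by (intro tendsto_intros isCont_tendsto_compose[OF isCont_Eh] x b)
  then have "(\<lambda>k. ennreal (?c k)) \<longlonglongrightarrow> ennreal (cost x a)"
    by (rule tendsto_ennrealI)
  then have "ennreal (cost x a) = liminf (\<lambda>k. ennreal (?c k))"
    by (simp add: lim_imp_Liminf)
  also have "\<dots> \<le> liminf (\<lambda>k. ennreal (cost (X k) (b k)))"
  proof (rule Liminf_mono)
    have "\<forall>\<^sub>F k in sequentially. a > 0 \<longrightarrow> b k > 0"
      using order_tendstoD(1)[OF b, of 0] by (cases "a > 0") auto
    then show "\<forall>\<^sub>F k in sequentially. ennreal (?c k) \<le> ennreal (cost (X k) (b k))"
      by eventually_elim (use K_pos in \<open>auto simp: one_step_cost_def intro!: ennreal_leI\<close>)
  qed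
  finally show ?thesis .
qed

text \<open>Fatou's lemma handles the expected future value and \<open>cost_liminf\<close> the
  immediate cost; superadditivity of the lower limit combines them.\<close>

lemma Q_value_liminf:
  assumes inc: "\<And>x. incseq (\<lambda>k. f k x)" and lsc: "\<And>k. lsc (f k)" and r: "strict_mono r"
    and x: "X \<longlonglongrightarrow> x" and b: "b \<longlonglongrightarrow> a" and pos: "\<And>k. 0 \<le> b k"
  shows "Q_value \<alpha> (\<lambda>x. SUP k. f k x) x a \<le> liminf (\<lambda>k. Q_value \<alpha> (f (r k)) (X k) (b k))"
proof -
  note [measurable] = borel_measurable_lsc[OF lsc]
  have "(\<integral>\<^sup>+\<omega>. (SUP k. f k (x + a - D \<omega>)) \<partial>M)
      \<le> (\<integral>\<^sup>+\<omega>. liminf (\<lambda>k. f (r k) (X k + b k - D \<omega>)) \<partial>M)"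
    by (intro nn_integral_mono lsc_incseq_liminf[OF inc lsc r] tendsto_intros x b)
  also have "\<dots> \<le> liminf (\<lambda>k. \<integral>\<^sup>+\<omega>. f (r k) (X k + b k - D \<omega>) \<partial>M)"
    by (intro nn_integral_liminf) measurable
  finally have *: "(\<integral>\<^sup>+\<omega>. (SUP k. f k (x + a - D \<omega>)) \<partial>M)
      \<le> liminf (\<lambda>k. \<integral>\<^sup>+\<omega>. f (r k) (X k + b k - D \<omega>) \<partial>M)" .
  have "Q_value \<alpha> (\<lambda>x. SUP k. f k x) x a \<le> liminf (\<lambda>k. ennreal (cost (X k) (b k)))
      + ennreal \<alpha> * liminf (\<lambda>k. \<integral>\<^sup>+\<omega>. f (r k) (X k + b k - D \<omega>) \<partial>M)"
    unfolding Q_value_def by (intro add_mono cost_liminf x b pos mult_left_mono *) auto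
  also have "\<dots> \<le> liminf (\<lambda>k. ennreal (cost (X k) (b k)))
      + liminf (\<lambda>k. ennreal \<alpha> * (\<integral>\<^sup>+\<omega>. f (r k) (X k + b k - D \<omega>) \<partial>M))"
    by (intro add_mono liminf_cmult_ennreal) auto
  also have "\<dots> \<le> liminf (\<lambda>k. Q_value \<alpha> (f (r k)) (X k) (b k))"
    unfolding Q_value_def by (rule liminf_add_ennreal)
  finally show ?thesis .
qed

text \<open>A constant \<open>f\<close> gives lower semicontinuity of \<open>bellman \<alpha> f\<close>; a constant \<open>X\<close> gives attainment of
  the infimum and its interchange with the supremum over \<open>k\<close>.\<close>

lemma bellman_liminf:
  assumes inc: "\<And>x. incseq (\<lambda>k. f k x)" and lsc: "\<And>k. lsc (f k)" and x: "X \<longlonglongrightarrow> x"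
  shows "\<exists>a\<ge>0. Q_value \<alpha> (\<lambda>x. SUP k. f k x) x a \<le> liminf (\<lambda>k. bellman \<alpha> (f k) (X k))"
proof (cases "liminf (\<lambda>k. bellman \<alpha> (f k) (X k)) = \<infinity>")
  case True then show ?thesis by (auto intro!: exI[of _ 0])
next
  case False
  let ?t = "\<lambda>k. bellman \<alpha> (f k) (X k)"
  define L where "L = liminf ?t"
  have L: "L < L + 1"
    using False by (cases L) (auto simp: L_def ennreal_less_iff simp flip: ennreal_1 ennreal_plus)
  obtain r0 where r0: "strict_mono r0" and lim0: "(?t \<circ> r0) \<longlonglongrightarrow> L"
    using liminf_subseq_lim[of ?t] by (auto simp: L_def)
  from order_tendstoD(2)[OF lim0 L] obtain N where N: "\<And>k. k \<ge> N \<Longrightarrow> ?t (r0 k) < L + 1"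
    by (auto simp: eventually_sequentially)
  define r where "r k = r0 (k + N)" for k
  have r: "strict_mono r"
    using r0 by (auto simp: strict_mono_def r_def)
  have lim: "(\<lambda>k. ?t (r k)) \<longlonglongrightarrow> L"
    using LIMSEQ_ignore_initial_segment[OF lim0, of N] by (simp add: r_def)
  \<comment> \<open>Near-minimizing actions along a subsequence that realizes the lower limit: the
    bound \<open>L + 1\<close> will confine them, and the error \<open>1 / Suc k\<close> vanishes in
    the limit.\<close>
  have "\<exists>a\<ge>0. Q_value \<alpha> (f (r k)) (X (r k)) a < L + 1 \<and>
      Q_value \<alpha> (f (r k)) (X (r k)) a < ?t (r k) + ennreal (1 / Suc k)" for k
  proof -
    have t: "?t (r k) < L + 1" using N[of "k + N"] by (simp add: r_def)
    then have "?t (r k) < \<infinity>" by (auto simp: less_top[symmetric])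
    then have "?t (r k) < ?t (r k) + ennreal (1 / Suc k)"
      by (cases "?t (r k)") (auto simp: ennreal_less_iff simp flip: ennreal_plus)
    with t have "bellman \<alpha> (f (r k)) (X (r k)) < min (L + 1) (?t (r k) + ennreal (1 / Suc k))"
      by simp
    then show ?thesis
      unfolding bellman_def[of _ _ "X (r k)"] INF_less_iff by auto
  qed
  then obtain a where a: "\<And>k. a k \<ge> 0" "\<And>k. Q_value \<alpha> (f (r k)) (X (r k)) (a k) < L + 1"
    "\<And>k. Q_value \<alpha> (f (r k)) (X (r k)) (a k) < ?t (r k) + ennreal (1 / Suc k)"
    by metis
  have "L + 1 \<noteq> \<infinity>" using False by (simp add: L_def)
  then obtain B where B: "L + 1 = ennreal B" "0 \<le> B" by (cases "L + 1") auto
  \<comment> \<open>The variable ordering cost alone stays below \<open>B\<close>, which puts all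
    these actions into one compact interval.\<close>
  have "a k \<in> {0..B / cbar}" for k
  proof -
    have "ennreal (cost (X (r k)) (a k)) < ennreal B"
      using a(2)[of k] B(1) unfolding Q_value_def by (metis le_iff_add order_le_less_trans)
    then have "cost (X (r k)) (a k) < B"
      using cost_nonneg[OF a(1), of "X (r k)" k] by (simp add: ennreal_less_iff)
    moreover have "cbar * a k \<le> cost (X (r k)) (a k)"
      using K_pos Eh_nonneg[of "X (r k) + a k"] by (simp add: one_step_cost_def)
    ultimately show ?thesis using a(1)[of k] cbar_pos by (simp add: field_simps)
  qed
  then obtain l r2 where l: "l \<in> {0..B / cbar}" and r2: "strict_mono r2" and al: "(a \<circ> r2) \<longlonglongrightarrow> l"
    using compact_imp_seq_compact[OF compact_Icc[of 0 "B / cbar"]] by (metis seq_compactE)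
  have rr: "strict_mono (\<lambda>k. r (r2 k))"
    using r r2 by (auto simp: strict_mono_def)
  have "Q_value \<alpha> (\<lambda>x. SUP k. f k x) x l
      \<le> liminf (\<lambda>k. Q_value \<alpha> (f (r (r2 k))) (X (r (r2 k))) (a (r2 k)))"
    using al LIMSEQ_subseq_LIMSEQ[OF x rr] a(1)
    by (intro Q_value_liminf[OF inc lsc rr]) (auto simp: comp_def)
  also have "\<dots> \<le> liminf (\<lambda>k. ?t (r (r2 k)) + ennreal (1 / Suc (r2 k)))"
    using a(3) by (intro Liminf_mono always_eventually allI) (simp add: less_imp_le)
  also have "\<dots> = L"
  proof (rule lim_imp_Liminf)
    have "(\<lambda>k. ?t (r k) + ennreal (1 / Suc k)) \<longlonglongrightarrow> L + ennreal 0"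
      using LIMSEQ_Suc[OF lim_1_over_n] by (intro tendsto_add lim tendsto_ennrealI) simp
    from LIMSEQ_subseq_LIMSEQ[OF this r2]
    show "(\<lambda>k. ?t (r (r2 k)) + ennreal (1 / Suc (r2 k))) \<longlonglongrightarrow> L"
      by (simp add: comp_def)
  qed simp
  finally show ?thesis using l by (auto simp: L_def)
qed

lemma lsc_bellman:
  assumes "lsc f" shows "lsc (bellman \<alpha> f)"
  unfolding lsc_def
proof safe
  fix X x assume "X \<longlonglongrightarrow> (x :: real)"
  from bellman_liminf[of "\<lambda>_. f", OF _ _ this, of \<alpha>] obtain a
    where "a \<ge> 0" "Q_value \<alpha> f x a \<le> liminf (\<lambda>k. bellman \<alpha> f (X k))"
    using assms by auto
  with bellman_le[of a \<alpha> f x] show "bellman \<alpha> f x \<le> liminf (\<lambda>k. bellman \<alpha> f (X k))"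
    by (meson order_trans)
qed

section \<open>Value iteration and its limit\<close>

primrec val_iter :: "real \<Rightarrow> nat \<Rightarrow> real \<Rightarrow> ennreal" where
  "val_iter \<alpha> 0 = (\<lambda>_. 0)"
| "val_iter \<alpha> (Suc n) = bellman \<alpha> (val_iter \<alpha> n)"

definition val_lim :: "real \<Rightarrow> real \<Rightarrow> ennreal" where
  "val_lim \<alpha> x = (SUP n. val_iter \<alpha> n x)"

lemma incseq_val_iter: "incseq (\<lambda>n. val_iter \<alpha> n x)"
proof (rule incseq_SucI)
  show "val_iter \<alpha> n x \<le> val_iter \<alpha> (Suc n) x" for n
    by (induction n arbitrary: x) (auto intro!: bellman_mono)
qed

lemma lsc_val_iter: "lsc (val_iter \<alpha> n)"
  by (induction n) (auto simp: lsc_bellman lsc_def[of "\<lambda>_. 0"])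

lemma lsc_val_lim: "lsc (val_lim \<alpha>)"
  unfolding val_lim_def[abs_def] by (intro lsc_SUP lsc_val_iter)

lemmas val_iter_measurable[measurable] = borel_measurable_lsc[OF lsc_val_iter]
lemmas val_lim_measurable[measurable] = borel_measurable_lsc[OF lsc_val_lim]

lemma val_lim_le_Q_value:
  assumes "0 \<le> a" shows "val_lim \<alpha> x \<le> Q_value \<alpha> (val_lim \<alpha>) x a"
  unfolding val_lim_def[of _ x]
proof (rule SUP_least)
  fix n
  have "val_iter \<alpha> n x \<le> val_iter \<alpha> (Suc n) x"
    by (rule incseqD[OF incseq_val_iter]) simp
  also have "\<dots> \<le> Q_value \<alpha> (val_iter \<alpha> n) x a"
    using bellman_le[OF assms] by simp
  also have "\<dots> \<le> Q_value \<alpha> (val_lim \<alpha>) x a"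
    by (intro Q_value_mono) (auto simp: val_lim_def intro: SUP_upper)
  finally show "val_iter \<alpha> n x \<le> Q_value \<alpha> (val_lim \<alpha>) x a" .
qed

text \<open>With the constant sequence \<open>x\<close>, \<open>bellman_liminf\<close> provides a
  limit of near-optimal actions of the iterates. Together with \<open>val_lim_le_Q_value\<close>
  this is the optimality equation for \<open>val_lim\<close>, with the minimum attained.\<close>

lemma ex_Q_value_le_val_lim: "\<exists>a\<ge>0. Q_value \<alpha> (val_lim \<alpha>) x a \<le> val_lim \<alpha> x"
proof -
  obtain a where a: "a \<ge> 0" "Q_value \<alpha> (val_lim \<alpha>) x a \<le> liminf (\<lambda>k. bellman \<alpha> (val_iter \<alpha> k) x)"
    using bellman_liminf[of "val_iter \<alpha>" "\<lambda>_. x" x \<alpha>] incseq_val_iter lsc_val_iter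
    by (auto simp: val_lim_def[abs_def])
  have "liminf (\<lambda>k. bellman \<alpha> (val_iter \<alpha> k) x) \<le> liminf (\<lambda>k. val_lim \<alpha> x)"
  proof (intro Liminf_mono always_eventually allI)
    show "bellman \<alpha> (val_iter \<alpha> k) x \<le> val_lim \<alpha> x" for k
      unfolding val_lim_def by (rule SUP_upper2[of "Suc k"]) auto
  qed
  with a show ?thesis by (auto simp: Liminf_const)
qed

lemma ED_nonneg: "0 \<le> expectation D"
  by (rule integral_nonneg_AE[OF D_nonneg])

text \<open>The bound stems from restocking to \<open>z\<close> in every period, the quotient
  dominating a geometric series of setup, replacement and holding costs. It gives finiteness of the
  value and, being affine in the demand, its integrability.\<close>

lemma val_lim_le:
  assumes \<alpha>: "0 \<le> \<alpha>" "\<alpha> < 1" and x: "x \<le> z"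
  shows "val_lim \<alpha> x \<le> ennreal (K + cbar * (z - x) + (Eh z + K + cbar * expectation D) / (1 - \<alpha>))"
proof -
  define C where "C = (Eh z + K + cbar * expectation D) / (1 - \<alpha>)"
  have C: "0 \<le> C"
    unfolding C_def using \<alpha> Eh_nonneg[of z] K_pos cbar_pos ED_nonneg
    by (intro divide_nonneg_nonneg add_nonneg_nonneg mult_nonneg_nonneg) auto
  have Ceq: "C = Eh z + K + cbar * expectation D + \<alpha> * C"
    using \<alpha> unfolding C_def by (simp add: field_simps)
  have "val_iter \<alpha> n x \<le> ennreal (K + cbar * (z - x) + C)" if "x \<le> z" for n x
    using that
  proof (induction n arbitrary: x)
    case 0 then show ?case by simp
  next
    case (Suc n)
    have "(\<integral>\<^sup>+\<omega>. val_iter \<alpha> n (x + (z - x) - D \<omega>) \<partial>M) \<le> (\<integral>\<^sup>+\<omega>. ennreal (K + cbar * D \<omega> + C) \<partial>M)"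
    proof (intro nn_integral_mono_AE)
      show "AE \<omega> in M. val_iter \<alpha> n (x + (z - x) - D \<omega>) \<le> ennreal (K + cbar * D \<omega> + C)"
        using D_nonneg
      proof eventually_elim
        case (elim \<omega>)
        with Suc.IH[of "z - D \<omega>"] show ?case by simp
      qed
    qed
    also have "\<dots> = ennreal (\<integral>\<omega>. K + cbar * D \<omega> + C \<partial>M)"
      using D_nonneg D_integrable C K_pos cbar_pos
      by (intro nn_integral_eq_integral) (auto elim!: eventually_mono)
    also have "(\<integral>\<omega>. K + cbar * D \<omega> + C \<partial>M) = K + cbar * expectation D + C"
      using D_integrable by (simp add: prob_space)
    finally have I: "(\<integral>\<^sup>+\<omega>. val_iter \<alpha> n (x + (z - x) - D \<omega>) \<partial>M) \<le> ennreal (K + cbar * expectation D + C)" .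
    have "val_iter \<alpha> (Suc n) x \<le> Q_value \<alpha> (val_iter \<alpha> n) x (z - x)"
      using Suc.prems by (auto intro: bellman_le)
    also have "\<dots> \<le> ennreal (K + cbar * (z - x) + Eh z) + ennreal \<alpha> * ennreal (K + cbar * expectation D + C)"
      unfolding Q_value_def using K_pos
      by (intro add_mono mult_left_mono I ennreal_leI) (auto simp: one_step_cost_def)
    also have "\<dots> = ennreal (K + cbar * (z - x) + Eh z + \<alpha> * (K + cbar * expectation D + C))"
      using \<alpha> Suc.prems K_pos cbar_pos Eh_nonneg[of z] ED_nonneg C
      by (simp add: ennreal_plus[symmetric] ennreal_mult[symmetric] del: ennreal_plus)
    also have "\<dots> \<le> ennreal (K + cbar * (z - x) + C)"
    proof (rule ennreal_leI)
      have "\<alpha> * (K + cbar * expectation D) \<le> 1 * (K + cbar * expectation D)"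
        using \<alpha> K_pos cbar_pos ED_nonneg by (intro mult_right_mono) auto
      then show "K + cbar * (z - x) + Eh z + \<alpha> * (K + cbar * expectation D + C) \<le> K + cbar * (z - x) + C"
        using Ceq by (simp add: algebra_simps)
    qed
    finally show ?case .
  qed
  then show ?thesis
    unfolding val_lim_def C_def[symmetric] using x by (intro SUP_least) auto
qed

section \<open>Comparison of the iteration limit with the costs of policies\<close>

lemma trajectory_Q_value:
  assumes \<pi>: "\<pi> \<in> policies" and f[measurable]: "f \<in> borel_measurable borel"
  shows "(\<integral>\<^sup>+\<omega>. Q_value \<alpha> f (fst (\<omega> t)) (snd (\<omega> t)) \<partial>trajectory_law M Ds x \<pi>) =
    (\<integral>\<^sup>+\<omega>. ennreal (cost (fst (\<omega> t)) (snd (\<omega> t))) \<partial>trajectory_law M Ds x \<pi>)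
    + ennreal \<alpha> * (\<integral>\<^sup>+\<omega>. f (fst (\<omega> (Suc t))) \<partial>trajectory_law M Ds x \<pi>)"
proof -
  have c: "(\<lambda>\<omega>. \<omega> t) \<in> measurable (trajectory_law M Ds x \<pi>) state_action_space"
    by (subst measurable_cong_sets[OF sets_trajectory_law[OF \<pi>] refl])
       (rule measurable_component_singleton, simp)
  have m: "(\<lambda>p. \<integral>\<^sup>+w. f (fst p + snd p - D w) \<partial>M) \<in> borel_measurable state_action_space"
    by measurable
  have c': "(\<lambda>p. ennreal (cost (fst p) (snd p))) \<in> borel_measurable state_action_space"
    by measurable
  show ?thesis
    unfolding Q_value_def nn_integral_trajectory_state_Suc[OF assms]
    using measurable_compose[OF c m] measurable_compose[OF c c']
    by (subst nn_integral_add) (auto simp: nn_integral_cmult)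
qed

definition policy_cost :: "real \<Rightarrow> real \<Rightarrow> policy \<Rightarrow> nat \<Rightarrow> ennreal" where
  "policy_cost \<alpha> x \<pi> t = ennreal (\<alpha> ^ t) *
     (\<integral>\<^sup>+\<omega>. ennreal (cost (fst (\<omega> t)) (snd (\<omega> t))) \<partial>trajectory_law M Ds x \<pi>)"

lemma discounted_value_eq_policy_cost:
  assumes "0 \<le> \<alpha>"
  shows "discounted_value M Ds D K cbar h \<alpha> x = (INF \<pi>\<in>policies. \<Sum>t. policy_cost \<alpha> x \<pi> t)"
  unfolding discounted_value_def
proof (intro INF_cong refl)
  fix \<pi> assume \<pi>: "\<pi> \<in> policies"
  have c: "(\<lambda>\<omega>. \<omega> t) \<in> measurable (trajectory_law M Ds x \<pi>) state_action_space" for t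
    by (subst measurable_cong_sets[OF sets_trajectory_law[OF \<pi>] refl])
       (rule measurable_component_singleton, simp)
  have c': "(\<lambda>p. ennreal (cost (fst p) (snd p))) \<in> borel_measurable state_action_space"
    by measurable
  have "(\<integral>\<^sup>+\<omega>. (\<Sum>t. ennreal (\<alpha> ^ t * cost (fst (\<omega> t)) (snd (\<omega> t)))) \<partial>trajectory_law M Ds x \<pi>) =
    (\<integral>\<^sup>+\<omega>. (\<Sum>t. ennreal (\<alpha> ^ t) * ennreal (cost (fst (\<omega> t)) (snd (\<omega> t)))) \<partial>trajectory_law M Ds x \<pi>)"
    using assms by (simp add: ennreal_mult')
  also have "\<dots> = (\<Sum>t. policy_cost \<alpha> x \<pi> t)"
    using measurable_compose[OF c c'] unfolding policy_cost_def
    by (subst nn_integral_suminf) (auto simp: nn_integral_cmult)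
  finally show "(\<integral>\<^sup>+\<omega>. (\<Sum>t. ennreal (\<alpha> ^ t * cost (fst (\<omega> t)) (snd (\<omega> t)))) \<partial>trajectory_law M Ds x \<pi>) =
    (\<Sum>t. policy_cost \<alpha> x \<pi> t)" .
qed

text \<open>The Bellman inequality is unrolled along the trajectory, with \<open>n - k\<close>
  periods to go after \<open>k\<close> steps. At \<open>k = n\<close> the remaining iterate is 0, so
  no terminal term has to be estimated.\<close>

lemma val_lim_le_policy_cost:
  assumes \<alpha>: "0 \<le> \<alpha>" and \<pi>: "\<pi> \<in> policies"
  shows "val_lim \<alpha> x \<le> (\<Sum>t. policy_cost \<alpha> x \<pi> t)"
  unfolding val_lim_def
proof (rule SUP_least)
  fix n
  let ?E = "\<lambda>k g. \<integral>\<^sup>+\<omega>. g (fst (\<omega> k)) \<partial>trajectory_law M Ds x \<pi>"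
  have "k \<le> n \<Longrightarrow> val_iter \<alpha> n x \<le> (\<Sum>t<k. policy_cost \<alpha> x \<pi> t)
      + ennreal (\<alpha> ^ k) * ?E k (val_iter \<alpha> (n - k))" for k
  proof (induction k)
    case 0 then show ?case
      by (simp add: nn_integral_trajectory_state_0[OF \<pi>])
  next
    case (Suc k)
    have "?E k (val_iter \<alpha> (n - k)) \<le>
      (\<integral>\<^sup>+\<omega>. Q_value \<alpha> (val_iter \<alpha> (n - Suc k)) (fst (\<omega> k)) (snd (\<omega> k)) \<partial>trajectory_law M Ds x \<pi>)"
    proof (rule nn_integral_mono)
      fix \<omega> assume "\<omega> \<in> space (trajectory_law M Ds x \<pi>)"
      then have "\<omega> \<in> space (\<Pi>\<^sub>M i\<in>UNIV. state_action_space)"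
        using sets_eq_imp_space_eq[OF sets_trajectory_law[OF \<pi>]] by simp
      then have "\<omega> k \<in> space state_action_space"
        by (auto simp: space_PiM)
      then have "0 \<le> snd (\<omega> k)"
        by (auto simp: space_pair_measure)
      moreover have "n - k = Suc (n - Suc k)" using Suc.prems by simp
      ultimately show "val_iter \<alpha> (n - k) (fst (\<omega> k)) \<le>
          Q_value \<alpha> (val_iter \<alpha> (n - Suc k)) (fst (\<omega> k)) (snd (\<omega> k))"
        by (auto intro: bellman_le)
    qed
    also note trajectory_Q_value[OF \<pi> val_iter_measurable]
    finally have "ennreal (\<alpha> ^ k) * ?E k (val_iter \<alpha> (n - k)) \<le> policy_cost \<alpha> x \<pi> k
        + ennreal (\<alpha> ^ Suc k) * ?E (Suc k) (val_iter \<alpha> (n - Suc k))"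
      using \<alpha> unfolding policy_cost_def
      by (subst power_Suc2, subst ennreal_mult, simp_all add: distrib_left[symmetric] mult.assoc mult_left_mono)
    then have "(\<Sum>t<k. policy_cost \<alpha> x \<pi> t) + ennreal (\<alpha> ^ k) * ?E k (val_iter \<alpha> (n - k))
      \<le> (\<Sum>t<Suc k. policy_cost \<alpha> x \<pi> t) + ennreal (\<alpha> ^ Suc k) * ?E (Suc k) (val_iter \<alpha> (n - Suc k))"
      unfolding sum.lessThan_Suc add.assoc by (rule add_left_mono)
    with Suc show ?case
      by (meson Suc_leD order_trans)
  qed
  from this[of n] have "val_iter \<alpha> n x \<le> (\<Sum>t<n. policy_cost \<alpha> x \<pi> t)"
    by simp
  also have "\<dots> \<le> (\<Sum>t. policy_cost \<alpha> x \<pi> t)"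
    by (intro sum_le_suminf) auto
  finally show "val_iter \<alpha> n x \<le> (\<Sum>t. policy_cost \<alpha> x \<pi> t)" .
qed

lemma stationary_policy_cost_le:
  assumes \<alpha>: "0 \<le> \<alpha>" and f[measurable]: "f \<in> borel_measurable borel" and pos: "\<And>y. 0 \<le> f y"
    and V[measurable]: "V \<in> borel_measurable borel" and le: "\<And>y. Q_value \<alpha> V y (f y) \<le> V y"
  shows "(\<Sum>t. policy_cost \<alpha> x (stationary_policy f) t) \<le> V x"
proof -
  let ?\<pi> = "stationary_policy f"
  note \<pi> = stationary_policy_in_policies[OF f pos]
  let ?E = "\<lambda>k g. \<integral>\<^sup>+\<omega>. g (fst (\<omega> k)) \<partial>trajectory_law M Ds x ?\<pi>"
  have "(\<Sum>t<k. policy_cost \<alpha> x ?\<pi> t) + ennreal (\<alpha> ^ k) * ?E k V \<le> V x" for k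
  proof (induction k)
    case 0 then show ?case
      by (simp add: nn_integral_trajectory_state_0[OF \<pi>])
  next
    case (Suc k)
    have "(\<integral>\<^sup>+\<omega>. ennreal (cost (fst (\<omega> k)) (snd (\<omega> k))) \<partial>trajectory_law M Ds x ?\<pi>)
        + ennreal \<alpha> * ?E (Suc k) V
      = (\<integral>\<^sup>+\<omega>. Q_value \<alpha> V (fst (\<omega> k)) (f (fst (\<omega> k))) \<partial>trajectory_law M Ds x ?\<pi>)"
      unfolding trajectory_Q_value[OF \<pi> V, symmetric]
      using nn_integral_trajectory_stationary[OF f pos Q_value_measurable[OF V], where t=k and x=x]
      by simp
    also have "\<dots> \<le> ?E k V"
      by (intro nn_integral_mono le)
    finally have "policy_cost \<alpha> x ?\<pi> k + ennreal (\<alpha> ^ Suc k) * ?E (Suc k) V \<le> ennreal (\<alpha> ^ k) * ?E k V"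
      using \<alpha> unfolding policy_cost_def
      by (subst power_Suc2, subst ennreal_mult, simp_all add: distrib_left[symmetric] mult.assoc mult_left_mono)
    then have "(\<Sum>t<Suc k. policy_cost \<alpha> x ?\<pi> t) + ennreal (\<alpha> ^ Suc k) * ?E (Suc k) V
      \<le> (\<Sum>t<k. policy_cost \<alpha> x ?\<pi> t) + ennreal (\<alpha> ^ k) * ?E k V"
      unfolding sum.lessThan_Suc add.assoc by (rule add_left_mono)
    then show ?case
      using Suc by (rule order_trans)
  qed
  then have "(\<Sum>t<k. policy_cost \<alpha> x ?\<pi> t) \<le> V x" for k
    by (meson le_iff_add order_trans)
  then show ?thesis
    unfolding suminf_eq_SUP by (intro SUP_least)
qed

text \<open>The real-valued counterpart of \<open>G_disc\<close>, with the value function as a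
  parameter; \<open>G_disc_eq\<close> connects the two.\<close>

definition G_fun :: "real \<Rightarrow> (real \<Rightarrow> real) \<Rightarrow> real \<Rightarrow> real" where
  "G_fun \<alpha> v y = cbar * y + Eh y + \<alpha> * expectation (\<lambda>\<omega>. v (y - D \<omega>))"

text \<open>The last two facts are the Bellman equation in terms of the level
  \<open>y = x + a\<close> after ordering, with the credit \<open>cbar * x\<close> moved to the
  other side. Identifying \<open>val_lim\<close> with the value also takes a measurable minimizing
  action, which monotonicity of the order-up-to level supplies.\<close>

lemma optimality_equation:
  assumes \<alpha>: "0 \<le> \<alpha>" "\<alpha> < 1"
  obtains v where "v \<in> borel_measurable borel" "\<And>x. 0 \<le> v x"
    "\<And>y. integrable M (\<lambda>\<omega>. v (y - D \<omega>))"
    "\<And>x. discounted_value M Ds D K cbar h \<alpha> x = ennreal (v x)"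
    "\<And>x y. x \<le> y \<Longrightarrow> v x + cbar * x \<le> K * of_bool (x < y) + G_fun \<alpha> v y"
    "\<And>x. \<exists>y\<ge>x. K * of_bool (x < y) + G_fun \<alpha> v y \<le> v x + cbar * x"
proof -
  define v where "v x = enn2real (val_lim \<alpha> x)" for x
  have fin: "val_lim \<alpha> x < \<infinity>" for x
    using order_le_less_trans[OF val_lim_le[OF \<alpha> order_refl]] by simp
  then have V: "val_lim \<alpha> x = ennreal (v x)" for x
    by (simp add: v_def)
  have v_meas[measurable]: "v \<in> borel_measurable borel"
    unfolding v_def[abs_def] by measurable
  have v_nonneg: "0 \<le> v x" for x
    by (simp add: v_def)
  have v_int: "integrable M (\<lambda>\<omega>. v (y - D \<omega>))" for y
  proof (rule Bochner_Integration.integrable_bound)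
    let ?g = "\<lambda>\<omega>. K + cbar * (y - (y - D \<omega>)) + (Eh y + K + cbar * expectation D) / (1 - \<alpha>)"
    show "integrable M ?g"
      using D_integrable by simp
    show "AE \<omega> in M. norm (v (y - D \<omega>)) \<le> norm (?g \<omega>)"
      using D_nonneg
    proof eventually_elim
      case (elim \<omega>)
      have "0 \<le> ?g \<omega>"
        using elim \<alpha> Eh_nonneg[of y] K_pos cbar_pos ED_nonneg
        by (intro add_nonneg_nonneg divide_nonneg_nonneg mult_nonneg_nonneg) auto
      moreover have "ennreal (v (y - D \<omega>)) \<le> ennreal (?g \<omega>)"
        using val_lim_le[OF \<alpha>, of "y - D \<omega>" y] elim by (simp add: V)
      ultimately show ?case
        using v_nonneg[of "y - D \<omega>"] by simp
    qed
  qed measurable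
  let ?G = "G_fun \<alpha> v"
  have nn: "(\<integral>\<^sup>+\<omega>. val_lim \<alpha> (y - D \<omega>) \<partial>M) = ennreal (expectation (\<lambda>\<omega>. v (y - D \<omega>)))" for y
    unfolding V by (rule nn_integral_eq_integral[OF v_int]) (simp add: v_nonneg)
  have Ev: "0 \<le> expectation (\<lambda>\<omega>. v (y - D \<omega>))" for y
    by (simp add: v_nonneg)
  have Q: "Q_value \<alpha> (val_lim \<alpha>) x a = ennreal (K * of_bool (a > 0) + ?G (x + a) - cbar * x)"
    and Q0: "0 \<le> K * of_bool (a > 0) + ?G (x + a) - cbar * x" if "0 \<le> a" for x a
  proof -
    have eq: "K * of_bool (a > 0) + ?G (x + a) - cbar * x
        = cost x a + \<alpha> * expectation (\<lambda>\<omega>. v (x + a - D \<omega>))"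
      by (simp add: G_fun_def one_step_cost_def algebra_simps)
    then show "Q_value \<alpha> (val_lim \<alpha>) x a = ennreal (K * of_bool (a > 0) + ?G (x + a) - cbar * x)"
      using that \<alpha> Ev[of "x + a"] by (simp add: Q_value_def nn cost_nonneg ennreal_mult)
    show "0 \<le> K * of_bool (a > 0) + ?G (x + a) - cbar * x"
      unfolding eq using that \<alpha> Ev[of "x + a"] by (simp add: cost_nonneg)
  qed
  have A: "v x + cbar * x \<le> K * of_bool (x < y) + ?G y" if "x \<le> y" for x y
  proof -
    have "ennreal (v x) \<le> ennreal (K * of_bool (y - x > 0) + ?G (x + (y - x)) - cbar * x)"
      using val_lim_le_Q_value[of "y - x" \<alpha> x] that by (subst Q[symmetric]) (auto simp: V)
    then show ?thesis
      using Q0[of "y - x" x] that v_nonneg[of x] by (simp add: ennreal_le_iff)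
  qed
  have B: "\<exists>y\<ge>x. K * of_bool (x < y) + ?G y \<le> v x + cbar * x" for x
  proof -
    obtain a where a: "0 \<le> a" "Q_value \<alpha> (val_lim \<alpha>) x a \<le> val_lim \<alpha> x"
      using ex_Q_value_le_val_lim by blast
    then have "K * of_bool (a > 0) + ?G (x + a) - cbar * x \<le> v x"
      using Q0[of a x] v_nonneg[of x] by (simp add: Q V ennreal_le_iff)
    then show ?thesis
      using a by (intro exI[of _ "x + a"]) (auto simp: algebra_simps)
  qed
  \<comment> \<open>On \<open>N\<close> not ordering is strictly worse than optimal, so some level
    above \<open>x\<close> is optimal. \<open>Y x\<close> collects the levels that attain the value
    when \<open>K\<close> is charged.\<close>
  define N where "N = {x. v x + cbar * x < ?G x}"
  define Y where "Y x = {y. x \<le> y \<and> ?G y \<le> v x + cbar * x - K}" for x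
  have Y_ne: "Y x \<noteq> {}" if "x \<in> N" for x
  proof -
    obtain y where y: "x \<le> y" "K * of_bool (x < y) + ?G y \<le> v x + cbar * x"
      using B by blast
    moreover have "x < y"
      using y that by (cases "x = y") (auto simp: N_def)
    ultimately show ?thesis by (auto simp: Y_def intro!: exI[of _ y])
  qed
  have Y_bdd: "bdd_below (Y x)" for x
    by (auto simp: Y_def bdd_below_def)
  \<comment> \<open>\<open>?G\<close> is lower semicontinuous: up to the continuous term
    \<open>cbar * y\<close> it is \<open>Q_value\<close> at action 0.\<close>
  have G_closed: "?G l \<le> \<gamma>" if X: "\<And>n. ?G (X n) \<le> \<gamma>" and l: "X \<longlonglongrightarrow> l" for X l \<gamma>
  proof -
    have Q1: "Q_value \<alpha> (val_lim \<alpha>) y 0 = ennreal (?G y - cbar * y)"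
      and Q2: "0 \<le> ?G y - cbar * y" for y
      using Q[of 0 y] Q0[of 0 y] by simp_all
    have "ennreal (?G l - cbar * l) \<le> liminf (\<lambda>n. ennreal (?G (X n) - cbar * X n))"
      using Q_value_liminf[of "\<lambda>_. val_lim \<alpha>" "\<lambda>n. n" X l "\<lambda>_. 0" 0 \<alpha>] lsc_val_lim l
      by (simp add: Q1 strict_mono_def)
    also have "\<dots> \<le> liminf (\<lambda>n. ennreal (\<gamma> - cbar * X n))"
      using X by (intro Liminf_mono always_eventually allI ennreal_leI) simp
    also have "\<dots> = ennreal (\<gamma> - cbar * l)"
      by (intro lim_imp_Liminf tendsto_ennrealI tendsto_intros l) simp
    finally have le: "ennreal (?G l - cbar * l) \<le> ennreal (\<gamma> - cbar * l)" .
    have "0 \<le> \<gamma> - cbar * l"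
    proof (rule LIMSEQ_le_const)
      show "(\<lambda>n. \<gamma> - cbar * X n) \<longlonglongrightarrow> \<gamma> - cbar * l"
        by (intro tendsto_intros l)
      have "0 \<le> \<gamma> - cbar * X n" for n
        using X[of n] Q2[of "X n"] by simp
      then show "\<exists>n0. \<forall>n\<ge>n0. 0 \<le> \<gamma> - cbar * X n" by blast
    qed
    then show ?thesis using le by (simp add: ennreal_le_iff)
  qed
  have Y_closed: "closed (Y x)" for x
    unfolding closed_sequential_limits Y_def
    by (auto intro: G_closed LIMSEQ_le_const)
  define ystar where "ystar x = Inf (Y x)" for x
  have ystar: "ystar x \<in> Y x" if "x \<in> N" for x
    unfolding ystar_def by (rule closed_contains_Inf[OF Y_ne[OF that] Y_bdd Y_closed])
  have ystar_le: "ystar x \<le> y" if "y \<in> Y x" for x y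
    unfolding ystar_def by (rule cInf_lower[OF that Y_bdd])
  \<comment> \<open>The smallest such level is monotone in \<open>x\<close>, hence Borel. If
    \<open>ystar x\<close> is at least \<open>x'\<close>, it can be used from \<open>x'\<close> as
    well; this gives \<open>v x' + cbar * x' \<le> v x + cbar * x\<close>, and so
    \<open>ystar x'\<close> lies in \<open>Y x\<close>.\<close>
  have "mono_on N ystar"
  proof (rule mono_onI)
    fix x x' assume x: "x \<in> N" and x': "x' \<in> N" and xx': "x \<le> x'"
    show "ystar x \<le> ystar x'"
    proof (cases "ystar x < x'")
      case True
      then show ?thesis using ystar[OF x'] by (simp add: Y_def)
    next
      case False
      have "K * of_bool (x' < ystar x) \<le> K" using K_pos by simp
      then have "v x' + cbar * x' \<le> K + ?G (ystar x)"
        using A[of x' "ystar x"] False by simp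
      then have "ystar x' \<in> Y x"
        using ystar[OF x] ystar[OF x'] xx' by (auto simp: Y_def)
      then show ?thesis by (rule ystar_le)
    qed
  qed
  then have ystar_meas: "ystar \<in> borel_measurable (restrict_space borel N)"
    by (rule borel_measurable_mono_on_fnc)
  have [measurable]: "?G \<in> borel_measurable borel"
    unfolding G_fun_def by measurable
  have N_sets: "N \<in> sets borel"
    unfolding N_def by measurable
  define f where "f x = (if x \<in> N then ystar x - x else 0)" for x
  have "(\<lambda>x. ystar x - x) \<in> borel_measurable (restrict_space borel N)"
    by (intro borel_measurable_diff ystar_meas measurable_restrict_space1) simp
  then have f_meas: "f \<in> borel_measurable borel"
    unfolding f_def[abs_def] using N_sets
    by (subst measurable_If_restrict_space_iff) (auto simp: measurable_restrict_space1)
  have f_nonneg: "0 \<le> f x" for x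
    using ystar[of x] by (auto simp: f_def Y_def)
  have f_opt: "Q_value \<alpha> (val_lim \<alpha>) x (f x) \<le> val_lim \<alpha> x" for x
  proof -
    have "K * of_bool (0 < f x) \<le> K" using K_pos by simp
    then have "K * of_bool (0 < f x) + ?G (x + f x) - cbar * x \<le> v x"
      using ystar[of x] by (cases "x \<in> N") (auto simp: f_def Y_def, auto simp: N_def)
    then show ?thesis
      unfolding Q[OF f_nonneg] V by (rule ennreal_leI)
  qed
  have "discounted_value M Ds D K cbar h \<alpha> x = val_lim \<alpha> x" for x
    unfolding discounted_value_eq_policy_cost[OF \<alpha>(1)]
  proof (rule antisym)
    have "(INF \<pi>\<in>policies. \<Sum>t. policy_cost \<alpha> x \<pi> t) \<le> (\<Sum>t. policy_cost \<alpha> x (stationary_policy f) t)"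
      by (intro INF_lower stationary_policy_in_policies f_meas f_nonneg)
    also have "\<dots> \<le> val_lim \<alpha> x"
      by (intro stationary_policy_cost_le \<alpha> f_meas f_nonneg val_lim_measurable f_opt)
    finally show "(INF \<pi>\<in>policies. \<Sum>t. policy_cost \<alpha> x \<pi> t) \<le> val_lim \<alpha> x" .
    show "val_lim \<alpha> x \<le> (INF \<pi>\<in>policies. \<Sum>t. policy_cost \<alpha> x \<pi> t)"
      by (intro INF_greatest val_lim_le_policy_cost \<alpha>)
  qed
  with that[of v] v_meas v_nonneg v_int A B V show ?thesis
    by simp
qed

lemma G_disc_eq:
  assumes \<alpha>: "0 \<le> \<alpha>" and v: "\<And>x. 0 \<le> v x" "\<And>y. integrable M (\<lambda>\<omega>. v (y - D \<omega>))"
    "\<And>x. discounted_value M Ds D K cbar h \<alpha> x = ennreal (v x)"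
  shows "G_disc M Ds D K cbar h \<alpha> y = ereal (G_fun \<alpha> v y)"
proof -
  have "(\<integral>\<^sup>+\<omega>. discounted_value M Ds D K cbar h \<alpha> (y - D \<omega>) \<partial>M)
      = ennreal (expectation (\<lambda>\<omega>. v (y - D \<omega>)))"
    unfolding v(3) by (rule nn_integral_eq_integral[OF v(2)]) (simp add: v(1))
  then show ?thesis
    by (simp add: G_disc_def G_fun_def v(1))
qed

lemma Eh_disc_eq:
  "Eh_disc M D cbar h \<alpha> y = Eh y + (1 - \<alpha>) * cbar * y + \<alpha> * cbar * expectation D"
proof -
  have "Eh_disc M D cbar h \<alpha> y = Eh y + (1 - \<alpha>) * cbar * (y - expectation D) + cbar * expectation D"
    unfolding Eh_disc_def h_disc_def using h_integrable D_integrable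
    by (simp add: prob_space)
  then show ?thesis by (simp add: algebra_simps)
qed

abbreviation H :: "real \<Rightarrow> real \<Rightarrow> real" where
  "H \<equiv> Eh_disc M D cbar h"

lemma isCont_H: "isCont (H \<alpha>) x"
  unfolding Eh_disc_eq[abs_def] by (intro continuous_intros isCont_Eh)

lemma continuous_on_H: "continuous_on A (H \<alpha>)"
  using isCont_H by (simp add: continuous_at_imp_continuous_on)

lemma H_diff: "H \<beta> x - H \<alpha> x = (\<beta> - \<alpha>) * (cbar * expectation D - cbar * x)"
  by (simp add: Eh_disc_eq algebra_simps)

end

section \<open>The stopping problem behind the lower threshold\<close>

text \<open>This isolates what the threshold analysis uses of the value function: integrability, the
  optimality equation and a minimizer of \<open>G_fun\<close>. The analysis then no longer refers to
  policies.\<close>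

locale discounted_solution = inventory_model +
  fixes \<alpha> :: real and v :: "real \<Rightarrow> real" and S :: real
  assumes \<alpha>: "0 \<le> \<alpha>" "\<alpha> < 1"
    and v_int: "\<And>y. integrable M (\<lambda>\<omega>. v (y - D \<omega>))"
    and v_le: "\<And>x y. x \<le> y \<Longrightarrow> v x + cbar * x \<le> K * of_bool (x < y) + G_fun \<alpha> v y"
    and ex_le_v: "\<And>x. \<exists>y\<ge>x. K * of_bool (x < y) + G_fun \<alpha> v y \<le> v x + cbar * x"
    and S_min: "\<And>y. G_fun \<alpha> v S \<le> G_fun \<alpha> v y"
begin

abbreviation G :: "real \<Rightarrow> real" where "G \<equiv> G_fun \<alpha> v"

text \<open>\<open>u x\<close> is the excess of the optimal cost over that of ordering up to \<open>S\<close> at once. For \<open>x \<le> S\<close>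
  it is the value of an optimal stopping problem with running cost \<open>H \<alpha> - lam\<close>, where stopping
  means placing an order.\<close>

definition u :: "real \<Rightarrow> real" where "u x = v x + cbar * x - K - G S"
text \<open>Charged in every period, \<open>lam\<close> has the discounted total
  \<open>K + G S\<close>.\<close>

definition lam :: real where "lam = (1 - \<alpha>) * (K + G S)"

lemma u_int: "integrable M (\<lambda>\<omega>. u (y - D \<omega>))"
  unfolding u_def using v_int D_integrable by simp

text \<open>Discounting the constant \<open>K + G S\<close> by \<open>\<alpha>\<close> leaves
  \<open>lam\<close>, and discounting the credit \<open>cbar * x\<close> leaves exactly the linear
  terms by which \<open>H \<alpha>\<close> differs from \<open>Eh\<close>.\<close>

lemma G_eq: "G y - K - G S = H \<alpha> y - lam + \<alpha> * expectation (\<lambda>\<omega>. u (y - D \<omega>))"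
proof -
  have E: "expectation (\<lambda>\<omega>. u (y - D \<omega>))
      = expectation (\<lambda>\<omega>. v (y - D \<omega>)) + cbar * y - cbar * expectation D - K - G S"
    unfolding u_def using v_int D_integrable by (simp add: prob_space algebra_simps)
  then show ?thesis
    by (simp add: E lam_def Eh_disc_eq G_fun_def[of _ _ y] algebra_simps)
qed

lemma expectation_u_le:
  assumes "\<And>z. z \<le> y \<Longrightarrow> u z \<le> B"
  shows "expectation (\<lambda>\<omega>. u (y - D \<omega>)) \<le> B"
proof -
  have "expectation (\<lambda>\<omega>. u (y - D \<omega>)) \<le> expectation (\<lambda>\<omega>. B)"
    by (rule integral_mono_AE[OF u_int])
       (use D_nonneg in \<open>auto elim!: eventually_mono intro!: assms\<close>)
  then show ?thesis by (simp add: prob_space)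
qed

lemma expectation_u_ge:
  assumes "\<And>z. z \<le> y \<Longrightarrow> B \<le> u z"
  shows "B \<le> expectation (\<lambda>\<omega>. u (y - D \<omega>))"
proof -
  have "expectation (\<lambda>\<omega>. B) \<le> expectation (\<lambda>\<omega>. u (y - D \<omega>))"
    by (rule integral_mono_AE[OF _ u_int])
       (use D_nonneg in \<open>auto elim!: eventually_mono intro!: assms\<close>)
  then show ?thesis by (simp add: prob_space)
qed

lemma u_ge: "- K \<le> u x"
proof -
  obtain y where "K * of_bool (x < y) + G y \<le> v x + cbar * x"
    using ex_le_v by blast
  moreover have "0 \<le> K * of_bool (x < y)" using K_pos by simp
  ultimately show ?thesis using S_min[of y] by (simp add: u_def)
qed

lemma u_le: "u x \<le> H \<alpha> x - lam + \<alpha> * expectation (\<lambda>\<omega>. u (x - D \<omega>))"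
  using v_le[of x x] G_eq[of x] by (simp add: u_def)

lemma u_le_G: "x \<le> y \<Longrightarrow> u x \<le> G y - G S"
proof -
  assume "x \<le> y"
  moreover have "K * of_bool (x < y) \<le> K" using K_pos by simp
  ultimately show ?thesis using v_le[of x y] by (simp add: u_def)
qed

lemma u_nonpos: "x \<le> S \<Longrightarrow> u x \<le> 0"
  using u_le_G[of x S] by simp

text \<open>The optimal level is either \<open>x\<close> itself, which is continuation, or a higher
  one, which costs at least \<open>K + G S\<close> and hence forces
  \<open>u x \<ge> 0\<close>.\<close>

lemma u_ge_min: "min 0 (H \<alpha> x - lam + \<alpha> * expectation (\<lambda>\<omega>. u (x - D \<omega>))) \<le> u x"
proof -
  obtain y where y: "x \<le> y" "K * of_bool (x < y) + G y \<le> v x + cbar * x"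
    using ex_le_v by blast
  then show ?thesis
    using G_eq[of x] S_min[of y] by (cases "x = y") (auto simp: u_def)
qed

lemma S_eq: "H \<alpha> S - lam + \<alpha> * expectation (\<lambda>\<omega>. u (S - D \<omega>)) = - K"
  using G_eq[of S] by simp

text \<open>At \<open>S\<close> continuation has value \<open>- K\<close>, while the discounted
  future contributes at least \<open>- \<alpha> * K\<close>; so the running cost
  \<open>H \<alpha> S - lam\<close> cannot be positive.\<close>

lemma H_S_le: "H \<alpha> S \<le> lam"
proof -
  have "\<alpha> * (- K) \<le> \<alpha> * expectation (\<lambda>\<omega>. u (S - D \<omega>))"
    using \<alpha> u_ge by (intro mult_left_mono expectation_u_ge) auto
  moreover have "\<alpha> * K \<le> 1 * K"
    using \<alpha> K_pos by (intro mult_right_mono) auto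
  ultimately show ?thesis using S_eq by simp
qed

text \<open>Ordering up to \<open>z\<close> bounds \<open>u\<close> by \<open>G z - G S\<close> at
  and below \<open>z\<close>. Inserting this into \<open>G_eq\<close> at \<open>z\<close> and using
  that \<open>S\<close> minimizes \<open>G\<close> gives the estimate.\<close>

lemma lam_le: "lam \<le> K + H \<alpha> z"
proof -
  have "\<alpha> * expectation (\<lambda>\<omega>. u (z - D \<omega>)) \<le> \<alpha> * (G z - G S)"
    using \<alpha> u_le_G by (intro mult_left_mono expectation_u_le) auto
  then have "(1 - \<alpha>) * (G z - G S) \<le> K + H \<alpha> z - lam"
    using G_eq[of z] by (simp add: algebra_simps)
  moreover have "0 \<le> (1 - \<alpha>) * (G z - G S)"
    using \<alpha> S_min[of z] by simp
  ultimately show ?thesis by simp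
qed

end

section \<open>The lower threshold as a level point of \<open>H \<alpha>\<close>\<close>

text \<open>\<open>lo\<close> bounds the sublevel set of \<open>H \<alpha>\<close> at
  \<open>lam\<close> from below. In the final proof one point serves for all discount factors close
  to 1, which makes the estimate \<open>K_le\<close> uniform.\<close>

locale discounted_threshold = discounted_solution +
  fixes lo :: real
  assumes quasi: "quasiconvex (H \<alpha>)"
    and lo: "\<And>x. x < lo \<Longrightarrow> lam < H \<alpha> x"
begin

text \<open>Defined through \<open>H \<alpha>\<close> rather than \<open>G\<close>, so that it can
  be followed as \<open>\<alpha>\<close> varies; \<open>threshold_eq\<close> shows that it is the
  threshold of the model.\<close>

definition s :: real where "s = Inf {x. H \<alpha> x \<le> lam}"

lemma H_s_le: "H \<alpha> s \<le> lam" and s_least: "H \<alpha> x \<le> lam \<Longrightarrow> s \<le> x"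
proof -
  let ?A = "{x. H \<alpha> x \<le> lam}"
  have bdd: "bdd_below ?A"
    using lo by (intro bdd_belowI[of _ lo]) (meson mem_Collect_eq not_le)
  have "closed ?A"
    using continuous_on_H[of UNIV] by (intro closed_Collect_le) auto
  then have "s \<in> ?A"
    unfolding s_def using H_S_le bdd by (intro closed_contains_Inf) auto
  then show "H \<alpha> s \<le> lam" by simp
  show "H \<alpha> x \<le> lam \<Longrightarrow> s \<le> x"
    unfolding s_def by (rule cInf_lower[OF _ bdd]) simp
qed

lemma s_le_S: "s \<le> S" using s_least H_S_le .

lemma lo_le_s: "lo \<le> s"
  using lo[of s] H_s_le by (meson not_le)

lemma H_s: "H \<alpha> s = lam"
proof (rule antisym[OF H_s_le])
  have "(H \<alpha> \<longlongrightarrow> H \<alpha> s) (at_left s)"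
    using isCont_H[where \<alpha>=\<alpha> and x=s] by (simp add: continuous_within filterlim_at_split)
  moreover have "\<forall>\<^sub>F x in at_left s. lam \<le> H \<alpha> x"
  proof -
    have "lam \<le> H \<alpha> x" if "x < s" for x
      using s_least[of x] that by (cases "H \<alpha> x \<le> lam") auto
    then show ?thesis
      by (simp add: eventually_at_filter)
  qed
  ultimately show "lam \<le> H \<alpha> s"
    by (intro tendsto_lowerbound) auto
qed

lemma H_le_lam: "s \<le> x \<Longrightarrow> x \<le> S \<Longrightarrow> H \<alpha> x \<le> lam"
  using quasiconvexD[OF quasi, of s x S] H_s_le H_S_le by simp

text \<open>Left of \<open>s\<close> continuing incurs a positive running cost, and demands keep the
  stock there. Thus the lower bound on \<open>u\<close>, starting at \<open>- K\<close>, improves by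
  the factor \<open>\<alpha>\<close> in each iteration.\<close>

lemma u_eq_0:
  assumes "x < s" shows "u x = 0"
proof (rule antisym)
  show "u x \<le> 0" using assms s_le_S by (intro u_nonpos) simp
  have "- K * \<alpha> ^ n \<le> u x" if "x < s" for n x
    using that
  proof (induction n arbitrary: x)
    case 0 then show ?case using u_ge by simp
  next
    case (Suc n)
    have "- K * \<alpha> ^ n \<le> expectation (\<lambda>\<omega>. u (x - D \<omega>))"
      using Suc by (intro expectation_u_ge) auto
    then have "\<alpha> * (- K * \<alpha> ^ n) \<le> \<alpha> * expectation (\<lambda>\<omega>. u (x - D \<omega>))"
      using \<alpha> by (intro mult_left_mono) auto
    moreover have "lam < H \<alpha> x" using s_least[of x] Suc.prems by (meson not_le)
    moreover have "- K * \<alpha> ^ Suc n \<le> 0" using K_pos \<alpha> by simp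
    ultimately have "- K * \<alpha> ^ Suc n
        \<le> min 0 (H \<alpha> x - lam + \<alpha> * expectation (\<lambda>\<omega>. u (x - D \<omega>)))"
      by (simp add: mult.left_commute)
    then show ?case using u_ge_min[of x] by (rule order_trans)
  qed
  moreover have "(\<lambda>n. - K * \<alpha> ^ n) \<longlonglongrightarrow> - K * 0"
    using \<alpha> by (intro tendsto_intros LIMSEQ_realpow_zero)
  ultimately show "0 \<le> u x"
    using assms by (intro LIMSEQ_le_const2[of "\<lambda>n. - K * \<alpha> ^ n"]) auto
qed

text \<open>Between \<open>s\<close> and \<open>S\<close> both the running cost and the expected
  future are nonpositive, so continuing attains the minimum in \<open>u_ge_min\<close>.\<close>

lemma u_eq:
  assumes "s \<le> x" "x \<le> S"
  shows "u x = H \<alpha> x - lam + \<alpha> * expectation (\<lambda>\<omega>. u (x - D \<omega>))"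
    and "H \<alpha> x - lam + \<alpha> * expectation (\<lambda>\<omega>. u (x - D \<omega>)) \<le> 0"
proof -
  have "expectation (\<lambda>\<omega>. u (x - D \<omega>)) \<le> 0"
    using assms by (intro expectation_u_le u_nonpos) simp
  then have "\<alpha> * expectation (\<lambda>\<omega>. u (x - D \<omega>)) \<le> 0"
    using \<alpha> by (simp add: mult_nonneg_nonpos)
  then show le: "H \<alpha> x - lam + \<alpha> * expectation (\<lambda>\<omega>. u (x - D \<omega>)) \<le> 0"
    using H_le_lam[OF assms] by simp
  show "u x = H \<alpha> x - lam + \<alpha> * expectation (\<lambda>\<omega>. u (x - D \<omega>))"
    using u_le[of x] u_ge_min[of x] le by simp
qed

text \<open>By \<open>G_eq\<close> the condition \<open>G x \<le> K + G S\<close> says that the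
  continuation value is nonpositive. That value is positive left of \<open>s\<close> and nonpositive
  between \<open>s\<close> and \<open>S\<close>, so the set is the interval
  \<open>{s..S}\<close>.\<close>

lemma threshold_eq: "(INF x\<in>{x. x \<le> S \<and> G x \<le> K + G S}. ereal x) = ereal s"
proof -
  have iff: "x \<le> S \<and> G x \<le> K + G S \<longleftrightarrow> s \<le> x \<and> x \<le> S" for x
  proof (cases "x < s")
    case True
    have "expectation (\<lambda>\<omega>. u (x - D \<omega>)) \<ge> 0"
      using True by (intro expectation_u_ge) (simp add: u_eq_0)
    then have "0 \<le> \<alpha> * expectation (\<lambda>\<omega>. u (x - D \<omega>))"
      using \<alpha> by simp
    moreover have "lam < H \<alpha> x" using s_least[of x] True by (meson not_le)
    ultimately have "K + G S < G x" using G_eq[of x] by linarith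
    then show ?thesis using True by simp
  next
    case False
    have "G x \<le> K + G S" if "x \<le> S"
      using u_eq(2)[of x] G_eq[of x] that False by linarith
    then show ?thesis using False by auto
  qed
  have eq: "{x. x \<le> S \<and> G x \<le> K + G S} = {s..S}"
    by (rule set_eqI) (unfold mem_Collect_eq atLeastAtMost_iff, rule iff)
  show ?thesis
    unfolding eq
  proof (rule antisym)
    show "(INF x\<in>{s..S}. ereal x) \<le> ereal s"
      using s_le_S by (intro INF_lower) simp
    show "ereal s \<le> (INF x\<in>{s..S}. ereal x)"
      by (intro INF_greatest) simp
  qed
qed

text \<open>A demand discounts the weight \<open>exp x\<close> by the factor \<open>E (exp (- D)) < 1\<close>, whatever \<open>\<alpha>\<close> is;
  so this bound survives the passage \<open>\<alpha> \<rightarrow> 1\<close>.\<close>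

lemma K_le:
  assumes \<epsilon>: "0 \<le> \<epsilon>" and H: "\<And>x. s \<le> x \<Longrightarrow> x \<le> S \<Longrightarrow> lam - \<epsilon> \<le> H \<alpha> x"
    and \<rho>_def: "\<rho> = expectation (\<lambda>\<omega>. exp (- D \<omega>))" and \<rho>: "\<rho> < 1"
  shows "K \<le> \<epsilon> / (1 - \<rho>) * exp (S - lo)"
proof -
  have exp_int: "integrable M (\<lambda>\<omega>. exp (- D \<omega>))"
    by (rule integrable_const_bound[where B=1])
       (use D_nonneg in \<open>auto elim!: eventually_mono\<close>)
  have \<rho>0: "0 \<le> \<rho>" by (simp add: \<rho>_def)
  \<comment> \<open>\<open>?b\<close> solves \<open>b (Suc n) = \<epsilon> + \<rho> * b n\<close>:
    one period adds at most \<open>\<epsilon>\<close> and contracts the weight by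
    \<open>\<rho>\<close>. Since \<open>lo \<le> s\<close>, the weight \<open>exp (x - lo)\<close>
    is at least 1 wherever \<open>u\<close> can be nonzero below \<open>S\<close>.\<close>
  let ?b = "\<lambda>n. \<epsilon> / (1 - \<rho>) + K * \<rho> ^ n"
  have b0: "0 \<le> ?b n" for n using \<epsilon> \<rho> \<rho>0 K_pos by simp
  have "- u x \<le> ?b n * exp (x - lo)" if "x \<le> S" for n x
    using that
  proof (induction n arbitrary: x)
    case 0
    show ?case
    proof (cases "x < s")
      case True then show ?thesis using b0[of 0] by (simp add: u_eq_0)
    next
      case False
      have "- u x \<le> K * 1" using u_ge[of x] by simp
      also have "\<dots> \<le> ?b 0 * exp (x - lo)"
        using False lo_le_s K_pos \<epsilon> \<rho> by (intro mult_mono) auto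
      finally show ?thesis .
    qed
  next
    case (Suc n)
    show ?case
    proof (cases "x < s")
      case True then show ?thesis using b0[of "Suc n"] by (simp add: u_eq_0 del: power_Suc)
    next
      case False
      have "expectation (\<lambda>\<omega>. - u (x - D \<omega>)) \<le> expectation (\<lambda>\<omega>. ?b n * exp (x - lo) * exp (- D \<omega>))"
      proof (rule integral_mono_AE)
        show "AE \<omega> in M. - u (x - D \<omega>) \<le> ?b n * exp (x - lo) * exp (- D \<omega>)"
          using D_nonneg
        proof eventually_elim
          case (elim \<omega>)
          have "x - D \<omega> - lo = (x - lo) + - D \<omega>" by simp
          then show ?case using Suc.IH[of "x - D \<omega>"] Suc.prems elim
            by (simp only: exp_add mult.assoc)
        qed
      qed (use u_int exp_int in auto)
      also have "\<dots> = ?b n * exp (x - lo) * \<rho>"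
        using exp_int by (simp add: \<rho>_def)
      finally have E: "- expectation (\<lambda>\<omega>. u (x - D \<omega>)) \<le> ?b n * exp (x - lo) * \<rho>"
        using u_int by simp
      have "\<alpha> * - expectation (\<lambda>\<omega>. u (x - D \<omega>)) \<le> \<alpha> * (?b n * exp (x - lo) * \<rho>)"
        using E \<alpha>(1) by (rule mult_left_mono)
      also have "\<dots> \<le> 1 * (?b n * exp (x - lo) * \<rho>)"
        using \<alpha> b0[of n] \<rho>0 by (intro mult_right_mono mult_nonneg_nonneg) auto
      finally have "\<alpha> * - expectation (\<lambda>\<omega>. u (x - D \<omega>)) \<le> 1 * (?b n * exp (x - lo) * \<rho>)" .
      moreover have "\<epsilon> \<le> \<epsilon> * exp (x - lo)"
        using \<epsilon> False lo_le_s by (simp add: mult_le_cancel_left1)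
      ultimately have "- u x \<le> \<epsilon> * exp (x - lo) + ?b n * exp (x - lo) * \<rho>"
        using u_eq(1)[of x] H[of x] False Suc.prems by simp
      also have "\<dots> = ?b (Suc n) * exp (x - lo)"
        using \<rho> by (simp add: field_simps)
      finally show ?thesis .
    qed
  qed
  \<comment> \<open>At \<open>S\<close> the left side is \<open>K\<close>, because continuation
    there is optimal and has value \<open>- K\<close>.\<close>
  from this[OF order_refl] have "K \<le> ?b n * exp (S - lo)" for n
    using u_eq(1)[OF s_le_S order_refl] unfolding S_eq by simp
  moreover have "(\<lambda>n. ?b n * exp (S - lo)) \<longlonglongrightarrow> (\<epsilon> / (1 - \<rho>) + K * 0) * exp (S - lo)"
    using \<rho> \<rho>0 by (intro tendsto_intros LIMSEQ_realpow_zero)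
  ultimately show ?thesis
    by (intro LIMSEQ_le_const[of "\<lambda>n. ?b n * exp (S - lo)"]) auto
qed

end

section \<open>Dependence on the discount factor\<close>

context discounted_solution
begin

text \<open>Only \<open>x > S\<close> is at issue. It suffices that \<open>u\<close> is
  nonincreasing up to \<open>X\<close>: from \<open>x\<close>, imitate the optimal decision at a
  lower \<open>y\<close>, ordering up to the same level \<open>z\<close> if \<open>x \<le> z\<close>
  and not ordering otherwise. In the latter case \<open>H \<alpha> x \<le> H \<alpha> z\<close> and
  the same demand acts on both stocks, so the error shrinks by \<open>\<alpha>\<close> per
  period.\<close>

lemma u_nonpos_antimono:
  assumes anti: "\<And>x y. y \<le> x \<Longrightarrow> x \<le> X \<Longrightarrow> H \<alpha> x \<le> H \<alpha> y" and xX: "x \<le> X"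
  shows "u x \<le> 0"
proof -
  define B where "B = G X - G S + K"
  have B: "0 \<le> B" using S_min[of X] K_pos by (simp add: B_def)
  have bound: "u x - u y \<le> B * \<alpha> ^ n" if "y \<le> x" "x \<le> X" for x y n
    using that
  proof (induction n arbitrary: x y)
    case 0
    then show ?case using u_le_G[of x X] u_ge[of y] by (simp add: B_def)
  next
    case (Suc n)
    obtain z where z: "y \<le> z" "K * of_bool (y < z) + G z \<le> v y + cbar * y"
      using ex_le_v by blast
    have Bn: "0 \<le> B * \<alpha> ^ Suc n" using B \<alpha> by simp
    show ?case
    proof (cases "x \<le> z")
      case True
      have "K * of_bool (x < z) \<le> K * of_bool (y < z)"
        using Suc.prems K_pos by simp
      then have "u x \<le> u y"
        using v_le[OF True] z by (simp add: u_def)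
      then show ?thesis using Bn by simp
    next
      case False
      have "0 \<le> K * of_bool (y < z)" using K_pos by simp
      then have "H \<alpha> z - lam + \<alpha> * expectation (\<lambda>\<omega>. u (z - D \<omega>)) \<le> u y"
        using z G_eq[of z] by (simp add: u_def)
      moreover have "H \<alpha> x \<le> H \<alpha> z"
        using False Suc.prems by (intro anti) auto
      moreover have "\<alpha> * (expectation (\<lambda>\<omega>. u (x - D \<omega>)) - expectation (\<lambda>\<omega>. u (z - D \<omega>)))
          \<le> \<alpha> * (B * \<alpha> ^ n)"
      proof (intro mult_left_mono \<alpha>)
        have "expectation (\<lambda>\<omega>. u (x - D \<omega>) - u (z - D \<omega>)) \<le> expectation (\<lambda>\<omega>. B * \<alpha> ^ n)"
        proof (rule integral_mono_AE)
          show "AE \<omega> in M. u (x - D \<omega>) - u (z - D \<omega>) \<le> B * \<alpha> ^ n"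
            using D_nonneg by eventually_elim (use False Suc.prems in \<open>auto intro!: Suc.IH\<close>)
        qed (use u_int in auto)
        then show "expectation (\<lambda>\<omega>. u (x - D \<omega>)) - expectation (\<lambda>\<omega>. u (z - D \<omega>)) \<le> B * \<alpha> ^ n"
          using u_int by (simp add: prob_space)
      qed
      ultimately show ?thesis
        using u_le[of x] by (simp add: algebra_simps)
    qed
  qed
  have "(\<lambda>n. B * \<alpha> ^ n) \<longlonglongrightarrow> B * 0"
    using \<alpha> by (intro tendsto_intros LIMSEQ_realpow_zero)
  then have "u x - u (min x S) \<le> B * 0"
    using bound[OF _ xX] by (intro LIMSEQ_le_const[of "\<lambda>n. B * \<alpha> ^ n"]) auto
  then show ?thesis
    using u_nonpos[of "min x S"] by simp
qed

end

context inventory_model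
begin

text \<open>If the gap were larger, continuing on \<open>{a.s..S}\<close> would be strictly cheaper
  for \<open>\<beta>\<close> than for \<open>\<alpha>\<close> in net running cost, while left of
  \<open>a.s\<close> one has \<open>a.u = 0\<close> and \<open>b.u \<le> 0\<close>. Hence
  \<open>b.u \<le> a.u\<close> up to \<open>S\<close>, strictly at \<open>S\<close> itself, where
  \<open>a.u S = - K\<close> is already the least possible value.\<close>

lemma lam_lipschitz:
  assumes a: "discounted_threshold M Ds D K cbar h \<alpha> v S lo"
    and b: "discounted_solution M Ds D K cbar h \<beta> v' S'"
    and X: "discounted_threshold.s M D K cbar h \<alpha> v S \<le> X"
    and anti: "\<And>x y. y \<le> x \<Longrightarrow> x \<le> X \<Longrightarrow> H \<beta> x \<le> H \<beta> y"
    and C: "\<And>x. lo \<le> x \<Longrightarrow> x \<le> S \<Longrightarrow> \<bar>cbar * expectation D - cbar * x\<bar> + K \<le> C"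
  shows "discounted_solution.lam M D K cbar h \<beta> v' S' - discounted_solution.lam M D K cbar h \<alpha> v S
    \<le> C * \<bar>\<beta> - \<alpha>\<bar>"
proof (rule ccontr)
  interpret a: discounted_threshold M Ds D K cbar h \<alpha> v S lo by (rule a)
  interpret b: discounted_solution M Ds D K cbar h \<beta> v' S' by (rule b)
  assume "\<not> b.lam - a.lam \<le> C * \<bar>\<beta> - \<alpha>\<bar>"
  then have gap: "C * \<bar>\<beta> - \<alpha>\<bar> < b.lam - a.lam" by simp
  define B where "B = b.G S - b.G S' + K"
  have B: "0 \<le> B" using b.S_min[of S] K_pos by (simp add: B_def)
  \<comment> \<open>The difference of net running costs consists of the change of \<open>H\<close>,
    the change of the discount applied to \<open>?Ea\<close> and the change of \<open>lam\<close>.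
    The first two together are at most \<open>C * \<bar>\<beta> - \<alpha>\<bar>\<close>, which is
    less than the third.\<close>
  have step: "b.u x - a.u x < \<beta> * expectation (\<lambda>\<omega>. b.u (x - D \<omega>) - a.u (x - D \<omega>))"
    if x: "a.s \<le> x" "x \<le> S" for x
  proof -
    let ?Ea = "expectation (\<lambda>\<omega>. a.u (x - D \<omega>))" and ?Eb = "expectation (\<lambda>\<omega>. b.u (x - D \<omega>))"
    have E: "\<bar>?Ea\<bar> \<le> K"
      using a.expectation_u_ge[of x "- K"] a.expectation_u_le[of x 0] a.u_ge a.u_nonpos x K_pos
      by (auto simp: abs_le_iff)
    have "(H \<beta> x - H \<alpha> x) + (\<beta> - \<alpha>) * ?Ea
        \<le> \<bar>\<beta> - \<alpha>\<bar> * \<bar>cbar * expectation D - cbar * x\<bar> + \<bar>\<beta> - \<alpha>\<bar> * \<bar>?Ea\<bar>"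
      unfolding H_diff abs_mult[symmetric] by (intro add_mono abs_ge_self)
    also have "\<dots> \<le> \<bar>\<beta> - \<alpha>\<bar> * (\<bar>cbar * expectation D - cbar * x\<bar> + K)"
      using E by (simp add: distrib_left mult_left_mono)
    also have "\<dots> \<le> \<bar>\<beta> - \<alpha>\<bar> * C"
      using C[of x] x a.lo_le_s by (intro mult_left_mono) auto
    finally have "(H \<beta> x - H \<alpha> x) + (\<beta> - \<alpha>) * ?Ea < b.lam - a.lam"
      using gap by (simp add: mult.commute)
    then have "b.u x - a.u x < \<beta> * ?Eb - \<beta> * ?Ea"
      using b.u_le[of x] a.u_eq(1)[OF x] by (simp add: algebra_simps)
    then show ?thesis
      using a.u_int b.u_int by (simp add: algebra_simps)
  qed
  have bound: "b.u x - a.u x \<le> B * \<beta> ^ n" if "x \<le> S" for n x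
    using that
  proof (induction n arbitrary: x)
    case 0
    then show ?case using b.u_le_G[of x S] a.u_ge[of x] by (simp add: B_def)
  next
    case (Suc n)
    have Bn: "0 \<le> B * \<beta> ^ Suc n" using B b.\<alpha> by simp
    show ?case
    proof (cases "x < a.s")
      case True
      then have "b.u x \<le> 0" using X by (intro b.u_nonpos_antimono[OF anti]) auto
      then show ?thesis using True Bn by (simp add: a.u_eq_0)
    next
      case False
      have "expectation (\<lambda>\<omega>. b.u (x - D \<omega>) - a.u (x - D \<omega>)) \<le> expectation (\<lambda>\<omega>. B * \<beta> ^ n)"
      proof (rule integral_mono_AE)
        show "AE \<omega> in M. b.u (x - D \<omega>) - a.u (x - D \<omega>) \<le> B * \<beta> ^ n"
          using D_nonneg by eventually_elim (use Suc.prems in \<open>auto intro!: Suc.IH\<close>)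
      qed (use a.u_int b.u_int in auto)
      then have "\<beta> * expectation (\<lambda>\<omega>. b.u (x - D \<omega>) - a.u (x - D \<omega>)) \<le> \<beta> * (B * \<beta> ^ n)"
        using b.\<alpha> by (intro mult_left_mono) (simp_all add: prob_space)
      with step[of x] False Suc.prems show ?thesis by (simp add: algebra_simps)
    qed
  qed
  have nonpos: "b.u x - a.u x \<le> 0" if "x \<le> S" for x
  proof -
    have "(\<lambda>n. B * \<beta> ^ n) \<longlonglongrightarrow> B * 0"
      using b.\<alpha> by (intro tendsto_intros LIMSEQ_realpow_zero)
    then have "b.u x - a.u x \<le> B * 0"
      using bound[OF that] by (intro LIMSEQ_le_const[of "\<lambda>n. B * \<beta> ^ n"]) auto
    then show ?thesis by simp
  qed
  have "expectation (\<lambda>\<omega>. b.u (S - D \<omega>) - a.u (S - D \<omega>)) \<le> expectation (\<lambda>\<omega>. 0)"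
  proof (rule integral_mono_AE)
    show "AE \<omega> in M. b.u (S - D \<omega>) - a.u (S - D \<omega>) \<le> 0"
      using D_nonneg by eventually_elim (auto intro!: nonpos[simplified])
  qed (use a.u_int b.u_int in auto)
  then have "\<beta> * expectation (\<lambda>\<omega>. b.u (S - D \<omega>) - a.u (S - D \<omega>)) \<le> 0"
    using b.\<alpha> by (simp add: mult_nonneg_nonpos)
  then have "b.u S - a.u S < 0"
    using step[OF a.s_le_S order_refl] by simp
  moreover have "a.u S = - K"
    using a.u_eq(1)[OF a.s_le_S order_refl] a.S_eq by simp
  ultimately show False using b.u_ge[of S] by simp
qed

section \<open>The limit of the thresholds\<close>

lemma expectation_exp_neg_D_less_1: "expectation (\<lambda>\<omega>. exp (- D \<omega>)) < 1"
proof -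
  have int: "integrable M (\<lambda>\<omega>. exp (- D \<omega>))"
    by (rule integrable_const_bound[where B=1])
       (use D_nonneg in \<open>auto elim!: eventually_mono\<close>)
  have nn: "AE \<omega> in M. 0 \<le> 1 - exp (- D \<omega>)"
    using D_nonneg by eventually_elim simp
  have "expectation (\<lambda>\<omega>. 1 - exp (- D \<omega>)) \<noteq> 0"
  proof
    assume "expectation (\<lambda>\<omega>. 1 - exp (- D \<omega>)) = 0"
    then have "AE \<omega> in M. 1 - exp (- D \<omega>) = 0"
      using integral_nonneg_eq_0_iff_AE[OF _ nn] int by simp
    then have "AE \<omega> in M. \<not> D \<omega> > 0"
      by eventually_elim simp
    then have "prob {\<omega> \<in> space M. D \<omega> > 0} = 0"
      by (subst prob_eq_0) auto
    with D_nontrivial show False by simp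
  qed
  moreover have "0 \<le> expectation (\<lambda>\<omega>. 1 - exp (- D \<omega>))"
    by (rule integral_nonneg_AE[OF nn])
  ultimately show ?thesis
    using int by (simp add: prob_space)
qed

lemma ex_Eh_gt: "\<exists>R. \<forall>x. R \<le> \<bar>x\<bar> \<longrightarrow> C < Eh x"
proof -
  have "\<forall>\<^sub>F x in at_infinity. C < Eh x"
    using Eh_coercive by (simp add: filterlim_at_top_dense)
  then show ?thesis by (simp add: eventually_at_infinity)
qed

text \<open>\<open>H 1\<close> is \<open>Eh\<close> plus a constant, so it is continuous and
  coercive and its minimizers form a nonempty compact set. This is why the \<open>LEAST\<close> in
  \<open>x_min\<close> denotes an actual minimizer.\<close>

lemma H_1_x_min_le: "H 1 (x_min M D cbar h 1) \<le> H 1 y"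
proof -
  obtain R where R: "\<And>x. R \<le> \<bar>x\<bar> \<Longrightarrow> Eh 0 < Eh x"
    using ex_Eh_gt[of "Eh 0"] by blast
  have big: "H 1 0 < H 1 x" if "R \<le> \<bar>x\<bar>" for x
    using R[OF that] by (simp add: Eh_disc_eq)
  have "0 < R" using R[of 0] by (cases "0 < R") auto
  obtain z where z: "z \<in> {-R..R}" "\<And>y. y \<in> {-R..R} \<Longrightarrow> H 1 z \<le> H 1 y"
    using continuous_attains_inf[OF compact_Icc _ continuous_on_H[of "{-R..R}" 1]] \<open>0 < R\<close> by auto
  have z_min: "H 1 z \<le> H 1 y" for y
    using z(2)[of y] z(2)[of 0] big[of y] \<open>0 < R\<close> by (cases "y \<in> {-R..R}") auto
  define A where "A = {x. H 1 x \<le> H 1 z}"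
  have A: "is_arg_min (H 1) (\<lambda>_. True) x \<longleftrightarrow> x \<in> A" for x
    using z_min unfolding is_arg_min_def A_def by (auto simp: not_less intro: order_trans)
  have "A \<subseteq> {-R..R}"
  proof
    fix x assume "x \<in> A"
    then have "H 1 x \<le> H 1 0" using z_min[of 0] by (simp add: A_def)
    then show "x \<in> {-R..R}" using big[of x] by (cases "R \<le> \<bar>x\<bar>") auto
  qed
  then have bdd: "bdd_below A" by (meson bdd_below_Icc bdd_below_mono)
  have "closed A"
    unfolding A_def using continuous_on_H[of UNIV 1] by (intro closed_Collect_le) auto
  then have "Inf A \<in> A"
    using bdd by (intro closed_contains_Inf) (auto simp: A_def)
  moreover have "x_min M D cbar h 1 = Inf A"
    unfolding x_min_def A using \<open>Inf A \<in> A\<close> bdd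
    by (intro Least_equality) (auto intro: cInf_lower)
  ultimately show ?thesis using z_min[of y] by (simp add: A_def)
qed

text \<open>A smaller value somewhere to the right of \<open>X\<close> forces a quasiconvex function
  to be nonincreasing up to \<open>X\<close>. The criterion is one strict inequality, hence stable
  under small changes of the discount factor.\<close>

lemma quasiconvex_H_antimono:
  assumes q: "quasiconvex (H \<alpha>)" and X: "H \<alpha> z < H \<alpha> X" "X < z" and "y \<le> x" "x \<le> X"
  shows "H \<alpha> x \<le> H \<alpha> y"
proof -
  have "H \<alpha> X \<le> max (H \<alpha> x) (H \<alpha> z)"
    using assms by (intro quasiconvexD[OF q]) auto
  moreover have "H \<alpha> x \<le> max (H \<alpha> y) (H \<alpha> z)"
    using assms by (intro quasiconvexD[OF q]) auto
  ultimately show ?thesis using X by (auto simp: max_def split: if_splits)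
qed

end

theorem theorem6p1:
  fixes M :: "'w measure" and Ds :: "nat \<Rightarrow> 'w \<Rightarrow> real" and D :: "'w \<Rightarrow> real"
    and K cbar :: real and h :: "real \<Rightarrow> real" and \<alpha>s :: real and S :: "real \<Rightarrow> real"
  assumes model: "inventory_model M Ds D K cbar h"
    and \<alpha>s: "0 \<le> \<alpha>s" "\<alpha>s < 1"
    and quasi: "\<And>\<alpha>. \<alpha> \<in> {\<alpha>s<..1} \<Longrightarrow> quasiconvex (Eh_disc M D cbar h \<alpha>)"
    and limit: "\<And>\<alpha>. \<alpha> \<in> {\<alpha>s<..1} \<Longrightarrow>
      \<exists>L :: ereal. ((\<lambda>x. ereal (Eh_disc M D cbar h \<alpha> x)) \<longlongrightarrow> L) at_bot \<and>
        L > ereal K + (INF x. ereal (Eh_disc M D cbar h \<alpha> x))"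
    and decr: "strict_antimono_on {..x_min M D cbar h 1} (Eh_disc M D cbar h 1)"
    and S: "\<And>\<alpha>. \<alpha> \<in> {\<alpha>s<..<1} \<Longrightarrow> is_arg_min (G_disc M Ds D K cbar h \<alpha>) (\<lambda>_. True) (S \<alpha>)"
  shows "\<exists>s :: real.
    ((\<lambda>\<alpha>. lower_threshold M Ds D K cbar h \<alpha> (S \<alpha>)) \<longlongrightarrow> ereal s) (at_left 1) \<and>
    s \<le> x_min M D cbar h 1"
proof -
  interpret inventory_model M Ds D K cbar h by (rule model)
  have "\<exists>v. discounted_solution M Ds D K cbar h \<alpha> v (S \<alpha>) \<and>
      (\<forall>y. G_disc M Ds D K cbar h \<alpha> y = ereal (G_fun \<alpha> v y))" if \<alpha>: "\<alpha> \<in> {\<alpha>s<..<1}" for \<alpha>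
  proof -
    have \<alpha>': "0 \<le> \<alpha>" "\<alpha> < 1" using \<alpha> \<alpha>s by auto
    obtain v where "v \<in> borel_measurable borel" and v: "\<And>x. 0 \<le> v x"
      "\<And>y. integrable M (\<lambda>\<omega>. v (y - D \<omega>))"
      "\<And>x. discounted_value M Ds D K cbar h \<alpha> x = ennreal (v x)"
      "\<And>x y. x \<le> y \<Longrightarrow> v x + cbar * x \<le> K * of_bool (x < y) + G_fun \<alpha> v y"
      "\<And>x. \<exists>y\<ge>x. K * of_bool (x < y) + G_fun \<alpha> v y \<le> v x + cbar * x"
      by (rule optimality_equation[OF \<alpha>']) (assumption | rule that)+
    note G = G_disc_eq[OF \<alpha>'(1) v(1,2,3)]
    have "G_fun \<alpha> v (S \<alpha>) \<le> G_fun \<alpha> v y" for y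
      using S[OF \<alpha>] by (auto simp: is_arg_min_def G not_less)
    then have "discounted_solution M Ds D K cbar h \<alpha> v (S \<alpha>)"
      using v \<alpha>' by unfold_locales auto
    with G show ?thesis by blast
  qed
  then obtain v where sol: "\<And>\<alpha>. \<alpha> \<in> {\<alpha>s<..<1} \<Longrightarrow> discounted_solution M Ds D K cbar h \<alpha> (v \<alpha>) (S \<alpha>)"
    and G: "\<And>\<alpha> y. \<alpha> \<in> {\<alpha>s<..<1} \<Longrightarrow> G_disc M Ds D K cbar h \<alpha> y = ereal (G_fun \<alpha> (v \<alpha>) y)"
    by metis
  define lam where "lam \<alpha> = discounted_solution.lam M D K cbar h \<alpha> (v \<alpha>) (S \<alpha>)" for \<alpha>
  define s where "s \<alpha> = discounted_threshold.s M D K cbar h \<alpha> (v \<alpha>) (S \<alpha>)" for \<alpha>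
  define xm where "xm = x_min M D cbar h 1"
  note xm = H_1_x_min_le[folded xm_def]
  have decr: "H 1 y < H 1 x" if "x < y" "y \<le> xm" for x y
    using that decr unfolding xm_def monotone_on_def by auto

  \<comment> \<open>\<open>x0\<close> comes from the limit assumption at discount factor 1 and later
    serves as \<open>lo\<close> for every discount factor near 1.\<close>
  have "\<exists>x0<xm. K + H 1 xm < H 1 x0"
  proof -
    have inf: "(INF x. ereal (H 1 x)) = ereal (H 1 xm)"
      by (intro antisym INF_greatest INF_lower) (auto simp: xm)
    obtain L where L: "((\<lambda>x. ereal (H 1 x)) \<longlongrightarrow> L) at_bot" "ereal (K + H 1 xm) < L"
      using limit[of 1] \<alpha>s unfolding inf by auto
    have "\<forall>\<^sub>F x in at_bot. x < xm \<and> ereal (K + H 1 xm) < ereal (H 1 x)"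
      by (intro eventually_conj eventually_gt_at_bot order_tendstoD(1)[OF L])
    from eventually_happens[OF this] show ?thesis by auto
  qed
  then obtain x0 where x0: "x0 < xm" "K + H 1 xm < H 1 x0" by blast

  \<comment> \<open>\<open>R\<close> will bound all \<open>S \<alpha>\<close>: from \<open>R\<close>
    on, \<open>Eh\<close> exceeds every possible value of \<open>K + H \<alpha> xm\<close>, whereas
    \<open>H \<alpha> (S \<alpha>)\<close> is at most \<open>lam \<alpha>\<close>, which is at most
    \<open>K + H \<alpha> xm\<close>.\<close>
  obtain R where R: "xm \<le> R" "0 \<le> R"
    "\<And>x. R \<le> x \<Longrightarrow> K + Eh xm + cbar * \<bar>xm\<bar> + cbar * expectation D < Eh x"
  proof -
    obtain R0 where "\<And>x. R0 \<le> \<bar>x\<bar> \<Longrightarrow> K + Eh xm + cbar * \<bar>xm\<bar> + cbar * expectation D < Eh x"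
      using ex_Eh_gt by blast
    then show ?thesis by (intro that[of "max 0 (max xm R0)"]) auto
  qed
  have S_le_R: "S \<alpha> \<le> R" if \<alpha>: "\<alpha> \<in> {\<alpha>s<..<1}" for \<alpha>
  proof (rule ccontr)
    interpret a: discounted_solution M Ds D K cbar h \<alpha> "v \<alpha>" "S \<alpha>" by (rule sol[OF \<alpha>])
    assume "\<not> S \<alpha> \<le> R"
    then have SR: "R \<le> S \<alpha>" by simp
    have "Eh (S \<alpha>) \<le> H \<alpha> (S \<alpha>)"
      using SR R(2) a.\<alpha> cbar_pos ED_nonneg by (simp add: Eh_disc_eq)
    also have "\<dots> \<le> K + H \<alpha> xm"
      using a.H_S_le a.lam_le[of xm] by simp
    also have "\<dots> \<le> K + (Eh xm + cbar * \<bar>xm\<bar> + cbar * expectation D)"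
    proof -
      have "(1 - \<alpha>) * cbar * xm \<le> (1 - \<alpha>) * cbar * \<bar>xm\<bar>"
        using a.\<alpha> cbar_pos by (intro mult_left_mono) auto
      also have "\<dots> \<le> 1 * cbar * \<bar>xm\<bar>"
        using a.\<alpha> cbar_pos by (intro mult_right_mono) auto
      finally have "(1 - \<alpha>) * cbar * xm \<le> 1 * cbar * \<bar>xm\<bar>" .
      moreover have "\<alpha> * cbar * expectation D \<le> 1 * cbar * expectation D"
        using a.\<alpha> cbar_pos ED_nonneg by (intro mult_right_mono) auto
      ultimately show ?thesis by (simp add: Eh_disc_eq)
    qed
    finally show False using R(3)[OF SR] by simp
  qed

  define \<rho> where "\<rho> = expectation (\<lambda>\<omega>. exp (- D \<omega>))"
  have \<rho>: "\<rho> < 1" unfolding \<rho>_def by (rule expectation_exp_neg_D_less_1)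
  \<comment> \<open>Chosen so that \<open>K_le\<close> with \<open>lo = x0\<close> and
    \<open>S \<alpha> \<le> R\<close> would yield \<open>K \<le> K / 2\<close>.\<close>
  define \<epsilon> where "\<epsilon> = K * (1 - \<rho>) / (2 * exp (R - x0))"
  have \<epsilon>: "0 < \<epsilon>" using \<rho> K_pos by (simp add: \<epsilon>_def)
  have \<epsilon>_eq: "\<epsilon> / (1 - \<rho>) * exp (R - x0) = K / 2"
    using \<rho> by (simp add: \<epsilon>_def)

  \<comment> \<open>\<open>X\<close> is going to dominate all \<open>s \<alpha>\<close> near 1.
    Lying strictly left of \<open>xm\<close>, it leaves room for
    \<open>quasiconvex_H_antimono\<close>; its nearly minimal value allows \<open>K_le\<close> to be
    applied.\<close>
  obtain X where X: "x0 \<le> X" "X < xm" "H 1 X < H 1 xm + \<epsilon> / 2"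
  proof -
    have "(H 1 \<longlongrightarrow> H 1 xm) (at_left xm)"
      using isCont_H[where \<alpha>=1 and x=xm] by (simp add: continuous_within filterlim_at_split)
    then have "\<forall>\<^sub>F x in at_left xm. H 1 x < H 1 xm + \<epsilon> / 2"
      using \<epsilon> by (intro order_tendstoD) auto
    moreover have "\<forall>\<^sub>F x in at_left xm. x \<in> {x0<..<xm}"
      using x0(1) by (rule eventually_at_left_real)
    ultimately have "\<forall>\<^sub>F x in at_left xm. H 1 x < H 1 xm + \<epsilon> / 2 \<and> x \<in> {x0<..<xm}"
      by (rule eventually_conj)
    from eventually_happens[OF this] show ?thesis
      using that by (auto intro: less_imp_le)
  qed
  have HX: "H 1 xm < H 1 X" using decr[OF X(2)] by simp

  define C where "C = cbar * expectation D + cbar * (\<bar>x0\<bar> + R)"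
  have C: "\<bar>cbar * expectation D - cbar * x\<bar> \<le> C" if "x0 \<le> x" "x \<le> R" for x
  proof -
    have "\<bar>cbar * expectation D - cbar * x\<bar> \<le> cbar * expectation D + cbar * \<bar>x\<bar>"
      using abs_triangle_ineq4[of "cbar * expectation D" "cbar * x"] cbar_pos ED_nonneg
      by (simp add: abs_mult)
    also have "cbar * \<bar>x\<bar> \<le> cbar * (\<bar>x0\<bar> + R)"
      using that R(2) cbar_pos by (intro mult_left_mono) auto
    finally show ?thesis by (simp add: C_def)
  qed
  have C0: "0 \<le> C" using C[of xm] x0 R by simp
  have H_near: "\<bar>H \<alpha> x - H 1 x\<bar> \<le> (1 - \<alpha>) * C" if "x0 \<le> x" "x \<le> R" "\<alpha> < 1" for \<alpha> x
    using C[OF that(1,2)] that(3) unfolding H_diff by (simp add: abs_mult mult_left_mono)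

  \<comment> \<open>Each of three strict inequalities for \<open>H 1\<close> has to survive a
    perturbation of size \<open>(1 - \<alpha>) * C\<close> at two points. The \<open>+ 1\<close>
    keeps the denominator positive and the estimate strict even for \<open>C = 0\<close>.\<close>
  define \<delta> where "\<delta> = min (min (H 1 x0 - K - H 1 xm) (H 1 X - H 1 xm)) (\<epsilon> / 2) / (2 * C + 1)"
  have \<delta>: "0 < \<delta>" using x0 HX \<epsilon> C0 by (simp add: \<delta>_def)
  define \<alpha>0 where "\<alpha>0 = max \<alpha>s (1 - \<delta>)"
  have \<alpha>0: "\<alpha>0 < 1" using \<delta> \<alpha>s by (simp add: \<alpha>0_def)
  have small: "2 * ((1 - \<alpha>) * C) < H 1 x0 - K - H 1 xm" "2 * ((1 - \<alpha>) * C) < H 1 X - H 1 xm"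
    "2 * ((1 - \<alpha>) * C) < \<epsilon> / 2" if "\<alpha> \<in> {\<alpha>0<..<1}" for \<alpha>
  proof -
    have "2 * ((1 - \<alpha>) * C) = (1 - \<alpha>) * (2 * C)" by simp
    also have "\<dots> \<le> \<delta> * (2 * C)"
      using that C0 by (intro mult_right_mono) (auto simp: \<alpha>0_def)
    also have "\<dots> < \<delta> * (2 * C + 1)"
      using \<delta> by simp
    also have "\<dots> = min (min (H 1 x0 - K - H 1 xm) (H 1 X - H 1 xm)) (\<epsilon> / 2)"
      using C0 by (simp add: \<delta>_def)
    finally show "2 * ((1 - \<alpha>) * C) < H 1 x0 - K - H 1 xm" "2 * ((1 - \<alpha>) * C) < H 1 X - H 1 xm"
      "2 * ((1 - \<alpha>) * C) < \<epsilon> / 2" by auto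
  qed
  have in_s: "\<alpha> \<in> {\<alpha>s<..<1}" if "\<alpha> \<in> {\<alpha>0<..<1}" for \<alpha>
    using that by (auto simp: \<alpha>0_def)

  have thr: "discounted_threshold M Ds D K cbar h \<alpha> (v \<alpha>) (S \<alpha>) x0" if \<alpha>: "\<alpha> \<in> {\<alpha>0<..<1}" for \<alpha>
  proof -
    interpret a: discounted_solution M Ds D K cbar h \<alpha> "v \<alpha>" "S \<alpha>" by (rule sol[OF in_s[OF \<alpha>]])
    have q: "quasiconvex (H \<alpha>)" using in_s[OF \<alpha>] by (intro quasi) auto
    have gap: "K + H \<alpha> xm < H \<alpha> x0"
      using H_near[of x0 \<alpha>] H_near[of xm \<alpha>] small(1)[OF \<alpha>] x0 R(1) a.\<alpha> by (simp add: abs_le_iff)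
    have "a.lam < H \<alpha> x" if "x < x0" for x
    proof -
      have "H \<alpha> x0 \<le> max (H \<alpha> x) (H \<alpha> xm)"
        using that x0 by (intro quasiconvexD[OF q]) auto
      then have "H \<alpha> x0 \<le> H \<alpha> x" using gap K_pos by (simp add: le_max_iff_disj)
      then show ?thesis using gap a.lam_le[of xm] by simp
    qed
    with q show ?thesis by unfold_locales auto
  qed
  have s_le: "s \<alpha> \<le> X" and s_ge: "x0 \<le> s \<alpha>" and H_s: "H \<alpha> (s \<alpha>) = lam \<alpha>"
    and threshold: "lower_threshold M Ds D K cbar h \<alpha> (S \<alpha>) = ereal (s \<alpha>)"
    if \<alpha>: "\<alpha> \<in> {\<alpha>0<..<1}" for \<alpha>
  proof -
    interpret a: discounted_threshold M Ds D K cbar h \<alpha> "v \<alpha>" "S \<alpha>" x0 by (rule thr[OF \<alpha>])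
    have SR: "S \<alpha> \<le> R" by (rule S_le_R[OF in_s[OF \<alpha>]])
    show "x0 \<le> s \<alpha>" unfolding s_def by (rule a.lo_le_s)
    show "H \<alpha> (s \<alpha>) = lam \<alpha>" unfolding s_def lam_def by (rule a.H_s)
    show "lower_threshold M Ds D K cbar h \<alpha> (S \<alpha>) = ereal (s \<alpha>)"
      using a.threshold_eq unfolding lower_threshold_def G[OF in_s[OF \<alpha>]] s_def by simp
    \<comment> \<open>Otherwise \<open>a.lam\<close> lies below \<open>H \<alpha> X\<close>, which
      exceeds every value of \<open>H \<alpha>\<close> between \<open>a.s\<close> and
      \<open>S \<alpha>\<close> by less than \<open>\<epsilon>\<close>; then \<open>K_le\<close>
      contradicts the choice of \<open>\<epsilon>\<close>.\<close>
    have "H \<alpha> X \<le> a.lam"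
    proof (rule ccontr)
      assume "\<not> H \<alpha> X \<le> a.lam"
      then have "a.lam - \<epsilon> \<le> H \<alpha> x" if "a.s \<le> x" "x \<le> S \<alpha>" for x
        using that H_near[of x \<alpha>] H_near[of X \<alpha>] small(3)[OF \<alpha>] X xm[of x] x0 R(1) a.\<alpha> a.lo_le_s SR
        by (simp add: abs_le_iff)
      then have "K \<le> \<epsilon> / (1 - \<rho>) * exp (S \<alpha> - x0)"
        using \<epsilon> \<rho> by (intro a.K_le[OF _ _ \<rho>_def]) auto
      also have "\<dots> \<le> \<epsilon> / (1 - \<rho>) * exp (R - x0)"
        using SR \<epsilon> \<rho> by (intro mult_left_mono) auto
      finally show False using \<epsilon>_eq K_pos by simp
    qed
    then show "s \<alpha> \<le> X" unfolding s_def by (rule a.s_least)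
  qed

  have lam_le: "lam \<beta> - lam \<alpha> \<le> (C + K) * \<bar>\<beta> - \<alpha>\<bar>"
    if \<alpha>: "\<alpha> \<in> {\<alpha>0<..<1}" and \<beta>: "\<beta> \<in> {\<alpha>0<..<1}" for \<alpha> \<beta>
    unfolding lam_def
  proof (rule lam_lipschitz[OF thr[OF \<alpha>] sol[OF in_s[OF \<beta>]]])
    show "discounted_threshold.s M D K cbar h \<alpha> (v \<alpha>) (S \<alpha>) \<le> X"
      using s_le[OF \<alpha>] by (simp add: s_def)
    show "\<bar>cbar * expectation D - cbar * x\<bar> + K \<le> C + K" if "x0 \<le> x" "x \<le> S \<alpha>" for x
      using C[of x] that S_le_R[OF in_s[OF \<alpha>]] by simp
    have "H \<beta> xm < H \<beta> X"
      using H_near[of X \<beta>] H_near[of xm \<beta>] small(2)[OF \<beta>] X x0 R(1) \<beta> by (simp add: abs_le_iff)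
    then show "H \<beta> x \<le> H \<beta> y" if "y \<le> x" "x \<le> X" for x y
      using that X(2) in_s[OF \<beta>] by (intro quasiconvex_H_antimono[OF quasi, of \<beta> xm X]) auto
  qed
  have "(C + K)-lipschitz_on {\<alpha>0<..<1} lam"
  proof (rule lipschitz_onI)
    show "dist (lam \<alpha>) (lam \<beta>) \<le> (C + K) * dist \<alpha> \<beta>"
      if "\<alpha> \<in> {\<alpha>0<..<1}" "\<beta> \<in> {\<alpha>0<..<1}" for \<alpha> \<beta>
      using lam_le[OF that] lam_le[OF that(2,1)] by (auto simp: dist_real_def abs_minus_commute)
  qed (use C0 K_pos in simp)
  \<comment> \<open>Uniform continuity up to the open end point gives convergence at 1 without
    identifying the limit.\<close>
  then have "uniformly_continuous_on {\<alpha>0<..<1} lam"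
    by (rule lipschitz_on_uniformly_continuous)
  moreover have "1 \<in> closure {\<alpha>0<..<1}" using \<alpha>0 by simp
  ultimately obtain l where "(lam \<longlongrightarrow> l) (at 1 within {\<alpha>0<..<1})"
    by (rule uniformly_continuous_on_extension_at_closure)
  moreover have "at 1 within {\<alpha>0<..<1} = at_left (1 :: real)"
    using \<alpha>0 by (intro at_within_nhd[of _ "{\<alpha>0<..}"]) auto
  ultimately have lam_lim: "(lam \<longlongrightarrow> l) (at_left 1)" by simp
  have ev: "\<forall>\<^sub>F \<alpha> in at_left 1. \<alpha> \<in> {\<alpha>0<..<1}"
    using \<alpha>0 by (rule eventually_at_left_real)

  \<comment> \<open>Here \<open>lam \<alpha> = H \<alpha> (s \<alpha>)\<close>, and
    \<open>H \<alpha>\<close> is uniformly close to \<open>H 1\<close> between \<open>x0\<close> and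
    \<open>R\<close>.\<close>
  have H_lim: "((\<lambda>\<alpha>. H 1 (s \<alpha>)) \<longlongrightarrow> l) (at_left 1)"
  proof (rule Lim_transform2[OF lam_lim])
    show "((\<lambda>\<alpha>. lam \<alpha> - H 1 (s \<alpha>)) \<longlongrightarrow> 0) (at_left 1)"
    proof (rule Lim_null_comparison)
      show "\<forall>\<^sub>F \<alpha> in at_left 1. norm (lam \<alpha> - H 1 (s \<alpha>)) \<le> (1 - \<alpha>) * C"
        using ev
      proof eventually_elim
        case (elim \<alpha>)
        then show ?case
          using H_near[of "s \<alpha>" \<alpha>] s_le[OF elim] s_ge[OF elim] X R(1) by (simp add: H_s)
      qed
      have "((\<lambda>\<alpha>. (1 - \<alpha>) * C) \<longlongrightarrow> (1 - 1) * C) (at_left 1)"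
        by (intro tendsto_intros)
      then show "((\<lambda>\<alpha>. (1 - \<alpha>) * C) \<longlongrightarrow> 0) (at_left 1)" by simp
    qed
  qed
  \<comment> \<open>The thresholds eventually lie in this compact interval, on which
    \<open>H 1\<close> is strictly decreasing and so has a continuous inverse \<open>g\<close>;
    applying \<open>g\<close> to \<open>H 1 (s \<alpha>)\<close> yields the limit of the
    thresholds.\<close>
  let ?I = "{x0..xm}"
  have inj: "inj_on (H 1) ?I"
  proof (rule linorder_inj_onI')
    fix x y assume "x \<in> ?I" "y \<in> ?I" "x < y"
    then show "H 1 x \<noteq> H 1 y" using decr[of x y] by simp
  qed
  define g where "g = the_inv_into ?I (H 1)"
  have g: "g (H 1 x) = x" if "x \<in> ?I" for x
    unfolding g_def by (rule the_inv_into_f_f[OF inj that])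
  have g_cont: "continuous_on (H 1 ` ?I) g"
    by (rule continuous_on_inv[OF continuous_on_H compact_Icc]) (use g in blast)
  have s_in: "\<forall>\<^sub>F \<alpha> in at_left 1. s \<alpha> \<in> ?I"
    using ev
  proof eventually_elim
    case (elim \<alpha>)
    then show ?case using s_le[of \<alpha>] s_ge[of \<alpha>] X(2) by simp
  qed
  have "closed (H 1 ` ?I)"
    by (intro compact_imp_closed compact_continuous_image continuous_on_H compact_Icc)
  moreover have H_in: "\<forall>\<^sub>F \<alpha> in at_left 1. H 1 (s \<alpha>) \<in> H 1 ` ?I"
    using s_in by eventually_elim (rule imageI)
  ultimately have l_in: "l \<in> H 1 ` ?I"
    using H_lim by (intro Lim_in_closed_set[of _ "\<lambda>\<alpha>. H 1 (s \<alpha>)" "at_left 1"]) simp_all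
  have "((\<lambda>\<alpha>. g (H 1 (s \<alpha>))) \<longlongrightarrow> g l) (at_left 1)"
    by (rule continuous_on_tendsto_compose[OF g_cont H_lim l_in H_in])
  then have "((\<lambda>\<alpha>. ereal (g (H 1 (s \<alpha>)))) \<longlongrightarrow> ereal (g l)) (at_left 1)"
    by (rule tendsto_ereal)
  moreover have "\<forall>\<^sub>F \<alpha> in at_left 1. lower_threshold M Ds D K cbar h \<alpha> (S \<alpha>) = ereal (g (H 1 (s \<alpha>)))"
    using ev s_in by eventually_elim (simp add: g threshold)
  ultimately have "((\<lambda>\<alpha>. lower_threshold M Ds D K cbar h \<alpha> (S \<alpha>)) \<longlongrightarrow> ereal (g l)) (at_left 1)"
    by (simp add: tendsto_cong)
  moreover have "g l \<le> xm"
  proof -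
    obtain x where "x \<in> ?I" "l = H 1 x" using l_in by blast
    then show ?thesis using g[of x] by simp
  qed
  ultimately show ?thesis unfolding xm_def by blast
qed

end
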